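(* Let $k$ and $d$ be positive integers, and let $G$ be a finite graph with $\mathrm{mad}(G) \leq 2k + \frac{2d}{d+k+1}$. Then the edge set of $G$ can be decomposed into $k+1$ pseudoforests $T_{1},\ldots,T_{k},F$ (pairwise edge-disjoint subgraphs whose edge sets together cover $E(G)$) such that each connected component of $F$ contains at most $d$ edges.
   Context: A pseudoforest is a graph in which each connected component contains at most one cycle. The maximum average degree of a graph $G$ is $\mathrm{mad}(G) := \max_{H \subseteq G} \frac{2e(H)}{v(H)}$, where the maximum is over all (nonempty) subgraphs $H$ of $G$, and $e(H)$, $v(H)$ denote the numbers of edges and vertices of $H$. *)

theory Defs
  imports Complex_Main
begin

text \<open>
  Graphs are undirected multigraphs: every edge \<open>e\<close> has a set \<open>ends G e\<close> of one (loop) or two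
  end vertices, and distinct edges may have the same ends.  Simple graphs are the case where
  \<open>ends G\<close> is injective on the edges and every edge has two ends.  The value of \<open>ends G\<close> outside
  \<open>edges G\<close> carries no meaning.
\<close>

record ('v, 'e) mgraph =
  verts :: "'v set"
  edges :: "'e set"
  ends  :: "'e \<Rightarrow> 'v set"

definition wf_graph :: "('v, 'e) mgraph \<Rightarrow> bool" where
  "wf_graph G \<longleftrightarrow>
     (\<forall>e\<in>edges G. ends G e \<subseteq> verts G \<and> (card (ends G e) = 1 \<or> card (ends G e) = 2))"

definition finite_graph :: "('v, 'e) mgraph \<Rightarrow> bool" where
  "finite_graph G \<longleftrightarrow> wf_graph G \<and> finite (verts G) \<and> finite (edges G)"

text \<open>Keeping the same function \<open>ends\<close> makes a subgraph determined by its vertices and edges, so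
  that equality of subgraphs of a fixed graph is equality as records.\<close>

definition subgraph :: "('v, 'e) mgraph \<Rightarrow> ('v, 'e) mgraph \<Rightarrow> bool" where
  "subgraph H G \<longleftrightarrow>
     wf_graph H \<and> verts H \<subseteq> verts G \<and> edges H \<subseteq> edges G \<and> ends H = ends G"

definition mad :: "('v, 'e) mgraph \<Rightarrow> real" where
  "mad G = Max {2 * real (card (edges H)) / real (card (verts H)) | H.
                  subgraph H G \<and> verts H \<noteq> {}}"

text \<open>The maximum in \<open>mad\<close> is over a finite nonempty set unless \<open>G\<close> has no vertices.\<close>

lemma finite_mad_set:
  assumes "finite_graph G"
  shows "finite {2 * real (card (edges H)) / real (card (verts H)) | H.
                   subgraph H G \<and> verts H \<noteq> {}}"
proof (rule finite_subset)
  show "{2 * real (card (edges H)) / real (card (verts H)) | H. subgraph H G \<and> verts H \<noteq> {}}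
        \<subseteq> (\<lambda>(A, B). 2 * real (card B) / real (card A)) ` (Pow (verts G) \<times> Pow (edges G))"
    by (force simp: subgraph_def)
  show "finite ((\<lambda>(A, B). 2 * real (card B) / real (card A)) ` (Pow (verts G) \<times> Pow (edges G)))"
    using assms by (simp add: finite_graph_def)
qed

lemma mad_set_nonempty:
  assumes "finite_graph G" "verts G \<noteq> {}"
  shows "{2 * real (card (edges H)) / real (card (verts H)) | H.
            subgraph H G \<and> verts H \<noteq> {}} \<noteq> {}"
  using assms by (force simp: subgraph_def finite_graph_def)

definition adj_rel :: "('v, 'e) mgraph \<Rightarrow> ('v \<times> 'v) set" where
  "adj_rel G = {(u, v). \<exists>e\<in>edges G. ends G e = {u, v}}"

definition component_of :: "('v, 'e) mgraph \<Rightarrow> 'v \<Rightarrow> ('v, 'e) mgraph" where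
  "component_of G v =
     (let W = {w \<in> verts G. (v, w) \<in> (adj_rel G)\<^sup>*}
      in \<lparr>verts = W, edges = {e \<in> edges G. ends G e \<subseteq> W}, ends = ends G\<rparr>)"

definition components :: "('v, 'e) mgraph \<Rightarrow> ('v, 'e) mgraph set" where
  "components G = component_of G ` verts G"

text \<open>A loop is a cycle of length 1 and two parallel edges form a cycle of length 2.\<close>

definition is_cycle :: "('v, 'e) mgraph \<Rightarrow> bool" where
  "is_cycle C \<longleftrightarrow>
     (\<exists>vs es. vs \<noteq> [] \<and> length es = length vs \<and> distinct vs \<and> distinct es \<and>
        verts C = set vs \<and> edges C = set es \<and>
        (\<forall>i<length vs. ends C (es ! i) = {vs ! i, vs ! (Suc i mod length vs)}))"

definition pseudoforest :: "('v, 'e) mgraph \<Rightarrow> bool" where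
  "pseudoforest G \<longleftrightarrow>
     wf_graph G \<and>
     (\<forall>K\<in>components G. \<forall>C D.
        subgraph C K \<and> is_cycle C \<and> subgraph D K \<and> is_cycle D \<longrightarrow> C = D)"

end

theory Submission
  imports Defs
begin

text \<open>
  Split the edges into a set \<open>B\<close> oriented with outdegrees at most \<open>k\<close>, which numbering the
  outgoing edges of each vertex turns into \<open>k\<close> pseudoforests, and a forest \<open>R\<close>.  Such a split exists:
  orient all edges with outdegrees at most \<open>k + 1\<close> and let \<open>R\<close> consist of the first arcs of shortest
  paths to vertices of outdegree at most \<open>k\<close>.  Choose \<open>B\<close> of maximal size, then make the largest
  component size \<open>M\<close> of \<open>R\<close> minimal and suppose \<open>M > d\<close>.  Among these splits, minimise first the
  number of vertices in components with \<open>M\<close> edges and then, lexicographically, the component sizes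
  met by an exploration that starts in such a component and enters each further component along an
  arc of \<open>B\<close>.

  Exchanging an arc that leads to a child component with an edge of \<open>R\<close> must not improve the split.
  This forces the sizes of a component and of any of its children to add up to at least \<open>d\<close>, and all
  children of size below \<open>d / (k + 1)\<close> of a component to hang at one vertex, so that there are at most
  \<open>k\<close> of them.  Averaging over each component together with its small children shows that the
  explored part has too many edges for the bound on the maximum average degree, because all its
  vertices have outdegree exactly \<open>k\<close> by the maximality of \<open>B\<close>.
\<close>

subsection \<open>Connectivity and bridges\<close>

locale finite_mgraph =
  fixes G :: "('v, 'e) mgraph"
  assumes finite_G: "finite_graph G"
begin

abbreviation "V \<equiv> verts G"
abbreviation "E \<equiv> edges G"
abbreviation "en \<equiv> ends G"

lemma finite_V: "finite V" and finite_E: "finite E"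
  using finite_G by (auto simp: finite_graph_def)

lemma ends_subset: "e \<in> E \<Longrightarrow> en e \<subseteq> V"
  using finite_G by (auto simp: finite_graph_def wf_graph_def)

lemma ends_pair:
  assumes "e \<in> E" "x \<in> en e"
  obtains y where "en e = {x, y}"
proof -
  have "card (en e) = 1 \<or> card (en e) = 2"
    using assms finite_G by (auto simp: finite_graph_def wf_graph_def)
  then have "\<exists>y. en e = {x, y}"
    using assms(2) by (auto simp: card_1_singleton_iff card_2_iff)
  then show thesis using that by blast
qed

lemma ends_nonempty:
  assumes "e \<in> E"
  obtains x where "x \<in> en e"
proof -
  have "card (en e) \<noteq> 0"
    using assms finite_G by (auto simp: finite_graph_def wf_graph_def)
  then have "en e \<noteq> {}" by auto
  then show thesis using that by blast
qed

definition adj :: "'e set \<Rightarrow> ('v \<times> 'v) set" where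
  "adj S = {(u, v). \<exists>e\<in>S. en e = {u, v}}"

definition conn :: "'e set \<Rightarrow> ('v \<times> 'v) set" where
  "conn S = (adj S)\<^sup>*"

definition cedges :: "'e set \<Rightarrow> 'v \<Rightarrow> 'e set" where
  "cedges S v = {e \<in> S. \<exists>u\<in>en e. (v, u) \<in> conn S}"

definition csize :: "'e set \<Rightarrow> 'v \<Rightarrow> nat" where
  "csize S v = card (cedges S v)"

text \<open>A forest is an edge set all of whose members are bridges; loops are excluded because
  \<open>conn\<close> is reflexive.\<close>

definition forest :: "'e set \<Rightarrow> bool" where
  "forest S \<longleftrightarrow> (\<forall>g\<in>S. \<forall>a b. en g = {a, b} \<longrightarrow> (a, b) \<notin> conn (S - {g}))"

lemma conn_refl [simp]: "(v, v) \<in> conn S"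
  by (simp add: conn_def)

lemma conn_sym: "(u, v) \<in> conn S \<Longrightarrow> (v, u) \<in> conn S"
proof -
  have "sym (adj S)" by (auto simp: sym_def adj_def insert_commute)
  then show "(u, v) \<in> conn S \<Longrightarrow> (v, u) \<in> conn S"
    unfolding conn_def by (meson sym_rtrancl symD)
qed

lemma conn_trans: "(u, v) \<in> conn S \<Longrightarrow> (v, w) \<in> conn S \<Longrightarrow> (u, w) \<in> conn S"
  unfolding conn_def by (rule rtrancl_trans)

lemma conn_mono: "(u, v) \<in> conn S \<Longrightarrow> S \<subseteq> T \<Longrightarrow> (u, v) \<in> conn T"
  unfolding conn_def by (erule rtrancl_mono[THEN subsetD, rotated]) (auto simp: adj_def)

lemma conn_edge: "e \<in> S \<Longrightarrow> en e = {u, v} \<Longrightarrow> (u, v) \<in> conn S"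
  unfolding conn_def adj_def by blast

lemma conn_ends:
  assumes "e \<in> S" "S \<subseteq> E" "a \<in> en e" "b \<in> en e"
  shows "(a, b) \<in> conn S"
proof -
  obtain y where "en e = {a, y}" using assms ends_pair[of e a] by blast
  then show ?thesis using assms conn_edge[of e S a y] by auto
qed

lemma conn_in_V: "(u, v) \<in> conn S \<Longrightarrow> S \<subseteq> E \<Longrightarrow> u \<in> V \<Longrightarrow> v \<in> V"
  unfolding conn_def
proof (induction rule: rtrancl_induct)
  case (step y z)
  then show ?case using ends_subset by (fastforce simp: adj_def)
qed auto

text \<open>A walk that uses \<open>f\<close> several times can be replaced by one that crosses
  \<open>f\<close> at most once, in one of its two directions.\<close>

lemma conn_insert:
  assumes "(u, v) \<in> conn (insert f S)" "en f = {a, b}"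
  shows "(u, v) \<in> conn S \<or> (u, a) \<in> conn S \<and> (b, v) \<in> conn S
    \<or> (u, b) \<in> conn S \<and> (a, v) \<in> conn S"
  using assms(1)[unfolded conn_def]
proof (induction rule: rtrancl_induct)
  case (step y z)
  then obtain e where e: "e \<in> insert f S" "en e = {y, z}" by (auto simp: adj_def)
  show ?case
  proof (cases "e \<in> S")
    case True
    then have "(y, z) \<in> conn S" using e conn_edge by blast
    then show ?thesis using step.IH conn_trans by blast
  next
    case False
    then have "{y, z} = {a, b}" using e assms(2) by auto
    then show ?thesis using step.IH by (auto simp: doubleton_eq_iff)
  qed
qed auto

lemma conn_remove:
  assumes "(u, a) \<in> conn S" "en g = {a, b}"
  shows "(u, a) \<in> conn (S - {g}) \<or> (u, b) \<in> conn (S - {g})"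
proof -
  have "(u, a) \<in> conn (insert g (S - {g}))" using assms(1) by (rule conn_mono) auto
  then show ?thesis using conn_insert[OF _ assms(2)] by blast
qed

lemma cedges_subset: "cedges S v \<subseteq> S"
  by (auto simp: cedges_def)

lemma finite_cedges: "S \<subseteq> E \<Longrightarrow> finite (cedges S v)"
  using cedges_subset finite_E by (metis finite_subset)

lemma cedges_cong: "(u, v) \<in> conn S \<Longrightarrow> cedges S u = cedges S v"
  unfolding cedges_def using conn_sym conn_trans by blast

lemma csize_cong: "(u, v) \<in> conn S \<Longrightarrow> csize S u = csize S v"
  by (simp add: csize_def cedges_cong)

lemma cedges_mono: "S \<subseteq> T \<Longrightarrow> cedges S v \<subseteq> cedges T v"
  unfolding cedges_def using conn_mono by blast

lemma csize_mono: "S \<subseteq> T \<Longrightarrow> T \<subseteq> E \<Longrightarrow> csize S v \<le> csize T v"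
  unfolding csize_def by (intro card_mono cedges_mono finite_cedges)

lemma csize_remove_less:
  assumes "S \<subseteq> E" "g \<in> cedges S v"
  shows "csize (S - {g}) v < csize S v"
proof -
  have "cedges (S - {g}) v \<subset> cedges S v"
    using assms(2) cedges_mono[of "S - {g}" S v] cedges_subset[of "S - {g}" v] by blast
  then show ?thesis unfolding csize_def using assms(1) by (intro psubset_card_mono finite_cedges)
qed

lemma conn_remove_foreign:
  assumes "g \<notin> cedges S v" "(v, u) \<in> conn S"
  shows "(v, u) \<in> conn (S - {g})"
  using assms(2)[unfolded conn_def]
proof (induction rule: rtrancl_induct)
  case (step y z)
  then obtain e where e: "e \<in> S" "en e = {y, z}" by (auto simp: adj_def)
  have "(v, y) \<in> conn S" using step.hyps(1) by (simp add: conn_def)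
  then have "e \<noteq> g" using e assms(1) by (auto simp: cedges_def)
  then have "(y, z) \<in> conn (S - {g})" using e by (intro conn_edge) auto
  then show ?case using step.IH conn_trans by blast
qed simp

lemma cedges_remove_foreign:
  assumes "g \<notin> cedges S v"
  shows "cedges (S - {g}) v = cedges S v"
proof
  show "cedges (S - {g}) v \<subseteq> cedges S v" by (rule cedges_mono) auto
  show "cedges S v \<subseteq> cedges (S - {g}) v"
    using assms conn_remove_foreign[OF assms] by (fastforce simp: cedges_def)
qed

text \<open>Deleting a bridge leaves two disjoint sides, the components of its ends; the final 1
  counts the bridge itself.\<close>

lemma csize_bridge:
  assumes "S \<subseteq> E" "g \<in> S" "en g = {a, b}" "(a, b) \<notin> conn (S - {g})"
  shows "csize S a = csize (S - {g}) a + csize (S - {g}) b + 1"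
proof -
  let ?T = "S - {g}"
  have "cedges S a = insert g (cedges ?T a \<union> cedges ?T b)"
  proof
    show "cedges S a \<subseteq> insert g (cedges ?T a \<union> cedges ?T b)"
    proof
      fix e assume "e \<in> cedges S a"
      then obtain u where u: "e \<in> S" "u \<in> en e" "(u, a) \<in> conn S"
        by (auto simp: cedges_def intro: conn_sym)
      then show "e \<in> insert g (cedges ?T a \<union> cedges ?T b)"
        using conn_remove[OF u(3) assms(3)] by (auto simp: cedges_def intro: conn_sym)
    qed
    have "(a, b) \<in> conn S" using assms by (intro conn_edge)
    then have "cedges S b = cedges S a" using cedges_cong by metis
    then show "insert g (cedges ?T a \<union> cedges ?T b) \<subseteq> cedges S a"
      using cedges_mono[of ?T S a] cedges_mono[of ?T S b] assms(2,3)
      by (auto simp: cedges_def)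
  qed
  moreover have "cedges ?T a \<inter> cedges ?T b = {}"
  proof (rule ccontr)
    assume "cedges ?T a \<inter> cedges ?T b \<noteq> {}"
    then obtain e u u' where e: "e \<in> ?T" "u \<in> en e" "u' \<in> en e"
      "(a, u) \<in> conn ?T" "(b, u') \<in> conn ?T"
      by (auto simp: cedges_def)
    have "(u, u') \<in> conn ?T" using e assms(1) by (intro conn_ends) auto
    then show False using e assms(4) conn_trans conn_sym by blast
  qed
  moreover have "finite (cedges ?T a)" "finite (cedges ?T b)"
    using assms(1) by (auto intro!: finite_cedges)
  moreover have "g \<notin> cedges ?T a \<union> cedges ?T b" using cedges_subset by blast
  ultimately show ?thesis unfolding csize_def by (simp add: card_Un_disjoint)
qed

lemma csize_join:
  assumes "insert f S \<subseteq> E" "f \<notin> S" "en f = {x, y}" "(x, y) \<notin> conn S"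
  shows "csize (insert f S) x = csize S x + csize S y + 1"
  using csize_bridge[of "insert f S" f x y] assms by simp

lemma csize_join_other:
  assumes "insert f S \<subseteq> E" "f \<notin> S" "en f = {x, y}" "(v, x) \<notin> conn (insert f S)"
  shows "csize (insert f S) v = csize S v"
proof -
  have "(y, x) \<in> conn (insert f S)"
    using assms(3) conn_edge[of f "insert f S" y x] by (auto simp: insert_commute)
  then have "f \<notin> cedges (insert f S) v"
    using assms(3,4) conn_trans by (auto simp: cedges_def)
  then show ?thesis
    using cedges_remove_foreign[of f "insert f S" v] assms(2) by (simp add: csize_def)
qed

lemma forest_subset: "forest T \<Longrightarrow> S \<subseteq> T \<Longrightarrow> forest S"
  unfolding forest_def by (meson Diff_mono conn_mono order_refl subset_iff)

text \<open>Were an old edge \<open>h\<close> no longer a bridge after adding \<open>f\<close>, a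
  connection of its ends through \<open>f\<close> would, closed up by \<open>h\<close>, join the
  ends of \<open>f\<close> inside \<open>S\<close>.\<close>

lemma forest_insert:
  assumes "forest S" "f \<notin> S" "en f = {x, y}" "(x, y) \<notin> conn S"
  shows "forest (insert f S)"
  unfolding forest_def
proof (intro ballI allI impI notI)
  fix h a b
  assume h: "h \<in> insert f S" "en h = {a, b}" "(a, b) \<in> conn (insert f S - {h})"
  show False
  proof (cases "h = f")
    case True
    then have "(a, b) \<in> conn S" using h assms(2) by simp
    moreover have "{a, b} = {x, y}" using True h(2) assms(3) by simp
    ultimately show False using assms(4) conn_sym by (auto simp: doubleton_eq_iff)
  next
    case False
    let ?T = "S - {h}"
    have hS: "h \<in> S" using False h by auto
    have sub: "(p, q) \<in> conn ?T \<Longrightarrow> (p, q) \<in> conn S" for p q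
      by (rule conn_mono) auto
    have ab: "(a, b) \<in> conn S" using hS h(2) by (rule conn_edge)
    have "insert f S - {h} = insert f ?T" using False by auto
    then have "(a, b) \<in> conn ?T \<or> (a, x) \<in> conn ?T \<and> (y, b) \<in> conn ?T
      \<or> (a, y) \<in> conn ?T \<and> (x, b) \<in> conn ?T"
      using conn_insert[of a b f ?T x y] h(3) assms(3) by simp
    moreover have "(a, b) \<notin> conn ?T" using assms(1) hS h(2) by (auto simp: forest_def)
    ultimately have "(a, x) \<in> conn S \<and> (y, b) \<in> conn S \<or> (a, y) \<in> conn S \<and> (x, b) \<in> conn S"
      using sub by blast
    then show False using ab assms(4) conn_sym conn_trans by meson
  qed
qed

text \<open>The edge \<open>g\<close> is the one by which a walk from \<open>x\<close> to
  \<open>w\<close> leaves \<open>x\<close> for the last time. The rest of the walk avoids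
  \<open>x\<close> and hence \<open>g\<close>, so a connection from \<open>x\<close> to
  \<open>w\<close> without \<open>g\<close> would join the ends of the bridge
  \<open>g\<close>.\<close>

lemma forest_bridge_towards:
  assumes "forest S" "(x, w) \<in> conn S" "x \<noteq> w"
  obtains g a where "g \<in> S" "en g = {x, a}" "(x, w) \<notin> conn (S - {g})"
proof -
  let ?r = "adj S \<inter> {(p, q). p \<noteq> x \<and> q \<noteq> x}"
  have "w \<noteq> x \<longrightarrow> (\<exists>a. (x, a) \<in> adj S \<and> (a, w) \<in> ?r\<^sup>*)"
    using assms(2)[unfolded conn_def]
  proof (induction rule: rtrancl_induct)
    case (step y z)
    show ?case
    proof (cases "y = x")
      case True
      then show ?thesis using step.hyps(2) by blast
    next
      case False
      show ?thesis
      proof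
        assume "z \<noteq> x"
        then have "(y, z) \<in> ?r" using step.hyps(2) False by auto
        then show "\<exists>a. (x, a) \<in> adj S \<and> (a, z) \<in> ?r\<^sup>*"
          using step.IH False by (meson rtrancl.rtrancl_into_rtrancl)
      qed
    qed
  qed simp
  then obtain a where a: "(x, a) \<in> adj S" "(a, w) \<in> ?r\<^sup>*" using assms(3) by blast
  then obtain g where g: "g \<in> S" "en g = {x, a}" by (auto simp: adj_def)
  have "?r \<subseteq> adj (S - {g})" using g by (fastforce simp: adj_def)
  then have "(a, w) \<in> conn (S - {g})"
    using a(2) rtrancl_mono unfolding conn_def by blast
  moreover have "(x, a) \<notin> conn (S - {g})" using assms(1) g by (auto simp: forest_def)
  ultimately have "(x, w) \<notin> conn (S - {g})" using conn_sym conn_trans by blast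
  then show thesis using that g by blast
qed

text \<open>Sending every other vertex of the component to its edge towards \<open>v\<close> is
  injective.\<close>

lemma card_component_le:
  assumes "S \<subseteq> E" "forest S" "v \<in> V"
  shows "card {u. (v, u) \<in> conn S} \<le> csize S v + 1"
proof -
  let ?C = "{u. (v, u) \<in> conn S}"
  have fin: "finite ?C"
    using conn_in_V assms finite_V by (intro finite_subset[OF _ finite_V]) auto
  have "\<exists>g a. g \<in> S \<and> en g = {u, a} \<and> (u, v) \<notin> conn (S - {g})" if "u \<in> ?C - {v}" for u
    using that assms(2) conn_sym by (auto elim!: forest_bridge_towards[of S u v])
  then obtain g a where g: "\<And>u. u \<in> ?C - {v} \<Longrightarrow>
      g u \<in> S \<and> en (g u) = {u, a u} \<and> (u, v) \<notin> conn (S - {g u})"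
    by metis
  \<comment> \<open>An edge serving both \<open>u\<close> and \<open>u'\<close> would have exactly
    these ends, but after deleting an edge at least one of its ends is still joined to
    \<open>v\<close>.\<close>
  have "inj_on g (?C - {v})"
  proof (rule inj_onI, rule ccontr)
    fix u u' assume u: "u \<in> ?C - {v}" "u' \<in> ?C - {v}" "g u = g u'" "u \<noteq> u'"
    then have "en (g u) = {u, u'}" using g[OF u(1)] g[OF u(2)] by auto
    then have "(v, u) \<in> conn (S - {g u}) \<or> (v, u') \<in> conn (S - {g u})"
      using u(1) conn_remove by auto
    then show False using g[OF u(1)] g[OF u(2)] u(3) conn_sym by metis
  qed
  moreover have "g ` (?C - {v}) \<subseteq> cedges S v" using g by (fastforce simp: cedges_def)
  ultimately have "card (?C - {v}) \<le> csize S v"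
    unfolding csize_def using assms(1) finite_cedges by (metis card_inj_on_le)
  then show ?thesis using fin by (simp add: card_Diff_singleton_if split: if_splits)
qed

subsection \<open>Orientations\<close>

definition orient :: "'e set \<Rightarrow> ('e \<Rightarrow> 'v) \<Rightarrow> bool" where
  "orient B t \<longleftrightarrow> B \<subseteq> E \<and> (\<forall>e\<in>B. t e \<in> en e)"

definition outs :: "'e set \<Rightarrow> ('e \<Rightarrow> 'v) \<Rightarrow> 'v \<Rightarrow> 'e set" where
  "outs B t v = {e \<in> B. t e = v}"

definition arcs :: "'e set \<Rightarrow> ('e \<Rightarrow> 'v) \<Rightarrow> ('v \<times> 'v) set" where
  "arcs B t = {(x, y). \<exists>e\<in>B. t e = x \<and> en e = {x, y}}"

lemma arcsE:
  assumes "(x, y) \<in> arcs B t"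
  obtains e where "e \<in> B" "t e = x" "en e = {x, y}"
  using assms by (auto simp: arcs_def)

lemma arcsI: "e \<in> B \<Longrightarrow> t e = x \<Longrightarrow> en e = {x, y} \<Longrightarrow> (x, y) \<in> arcs B t"
  by (auto simp: arcs_def)

lemma finite_outs: "B \<subseteq> E \<Longrightarrow> finite (outs B t v)"
  unfolding outs_def using finite_E by (metis Collect_subset finite_subset)

lemma arcs_in_V: "(x, y) \<in> arcs B t \<Longrightarrow> B \<subseteq> E \<Longrightarrow> x \<in> V \<and> y \<in> V"
  using ends_subset by (fastforce elim!: arcsE)

lemma reach_in_V: "(x, y) \<in> (arcs B t)\<^sup>* \<Longrightarrow> B \<subseteq> E \<Longrightarrow> x \<in> V \<Longrightarrow> y \<in> V"
  by (induction rule: rtrancl_induct) (auto dest: arcs_in_V)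

text \<open>Reversing a shortest path from \<open>z\<close> to \<open>u\<close> makes room at \<open>z\<close> for one more edge.\<close>

lemma shift_orientation_aux:
  assumes "orient B t" "g \<in> E - B" "z \<in> en g"
    and "(z, u) \<in> (arcs B t \<inter> P \<times> UNIV) ^^ n"
  shows "\<exists>t'. orient (insert g B) t' \<and>
    (\<forall>v. card (outs (insert g B) t' v) = card (outs B t v) + (if v = u then 1 else 0)) \<and>
    (\<forall>e\<in>B. t e \<notin> P \<longrightarrow> t' e = t e)"
  using assms(1,4)
proof (induction n arbitrary: t u rule: less_induct)
  case (less n)
  have BE: "B \<subseteq> E" using less.prems(1) by (simp add: orient_def)
  show ?case
  proof (cases n)
    case 0
    then have zu: "u = z" using less.prems(2) by simp
    define t' where "t' = t(g := z)"
    have "orient (insert g B) t'" using less.prems(1) assms(2,3) by (auto simp: orient_def t'_def)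
    moreover have "outs (insert g B) t' v = (if v = u then insert g (outs B t v) else outs B t v)"
      for v using assms(2) zu by (auto simp: outs_def t'_def)
    moreover have "g \<notin> outs B t u" using assms(2) by (auto simp: outs_def)
    moreover have "\<forall>e\<in>B. t' e = t e" using assms(2) by (auto simp: t'_def)
    ultimately show ?thesis using BE finite_outs by (intro exI[of _ t']) simp
  next
    case (Suc m)
    obtain p where p: "p 0 = z" "p n = u"
      "\<And>i. i < n \<Longrightarrow> (p i, p (Suc i)) \<in> arcs B t \<inter> P \<times> UNIV"
      using less.prems(2) unfolding relpow_fun_conv by blast
    show ?thesis
    \<comment> \<open>If the walk meets \<open>u\<close> early, its initial segment is a shorter
      walk to \<open>u\<close>.\<close>
    proof (cases "\<exists>i<n. p i = u")
      case True
      then obtain i where i: "i < n" "p i = u" by blast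
      then have "(z, u) \<in> (arcs B t \<inter> P \<times> UNIV) ^^ i"
        unfolding relpow_fun_conv using p by (intro exI[of _ p]) auto
      then show ?thesis using less.IH[OF i(1) less.prems(1)] by blast
    next
      case False
      obtain e where e: "e \<in> B" "t e = p m" "en e = {p m, u}"
        using p(3)[of m] p(2) Suc by (auto elim!: arcsE)
      have pm: "p m \<noteq> u" using False Suc by auto
      \<comment> \<open>Only the last arc is reversed here: \<open>u\<close> gains an outgoing edge
        and \<open>p m\<close> gains a free place, to which the shorter walk leads. The earlier arcs
        survive because they avoid \<open>u\<close>.\<close>
      let ?t = "t(e := u)"
      have "orient B ?t" using less.prems(1) e by (auto simp: orient_def)
      moreover have "(p i, p (Suc i)) \<in> arcs B ?t \<inter> P \<times> UNIV" if i: "i < m" for i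
      proof -
        obtain e' where e': "e' \<in> B" "t e' = p i" "en e' = {p i, p (Suc i)}" "p i \<in> P"
          using p(3)[of i] i Suc by (auto elim!: arcsE)
        have "p i \<noteq> u" "p (Suc i) \<noteq> u" using False i Suc by auto
        then have "u \<notin> en e'" "u \<in> en e" using e' e by auto
        then have "e' \<noteq> e" by blast
        then show ?thesis using e' by (auto simp: arcs_def)
      qed
      then have "(z, p m) \<in> (arcs B ?t \<inter> P \<times> UNIV) ^^ m"
        unfolding relpow_fun_conv using p(1) by blast
      ultimately obtain t' where t': "orient (insert g B) t'"
        "\<And>v. card (outs (insert g B) t' v) = card (outs B ?t v) + (if v = p m then 1 else 0)"
        "\<And>e. e \<in> B \<Longrightarrow> ?t e \<notin> P \<Longrightarrow> t' e = ?t e"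
        using less.IH[of m ?t "p m"] Suc by blast
      have "card (outs B ?t v) + (if v = p m then 1 else 0)
          = card (outs B t v) + (if v = u then 1 else 0)" for v
      proof -
        have out: "outs B ?t v = (if v = u then insert e (outs B t u)
          else if v = p m then outs B t v - {e} else outs B t v)"
          using e pm by (auto simp: outs_def)
        have "e \<in> outs B t (p m)" "e \<notin> outs B t u" using e pm by (auto simp: outs_def)
        then show ?thesis
          unfolding out using pm finite_outs[OF BE] card_Suc_Diff1[of "outs B t (p m)" e] by auto
      qed
      moreover have "t' e' = t e'" if "e' \<in> B" "t e' \<notin> P" for e'
      proof -
        have "p m \<in> P" using p(3)[of m] Suc by auto
        then have "e' \<noteq> e" using that e by auto
        then show ?thesis using t'(3)[of e'] that by auto
      qed
      ultimately show ?thesis using t'(1,2) by (intro exI[of _ t']) auto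
    qed
  qed
qed

lemma shift_orientation:
  assumes "orient B t" "g \<in> E - B" "z \<in> en g" "(z, u) \<in> (arcs B t \<inter> P \<times> UNIV)\<^sup>*"
  obtains t' where "orient (insert g B) t'"
    "\<And>v. card (outs (insert g B) t' v) = card (outs B t v) + (if v = u then 1 else 0)"
    "\<And>e. e \<in> B \<Longrightarrow> t e \<notin> P \<Longrightarrow> t' e = t e"
proof -
  obtain n where "(z, u) \<in> (arcs B t \<inter> P \<times> UNIV) ^^ n"
    using assms(4) rtrancl_imp_relpow by blast
  then show thesis using shift_orientation_aux[OF assms(1-3)] that by blast
qed

lemma reach_avoiding_target:
  assumes "(z, x) \<in> r\<^sup>*"
  shows "(z, x) \<in> (r \<inter> {(p, q). p \<noteq> x})\<^sup>*"
  using assms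
proof (induction rule: converse_rtrancl_induct)
  case (step y z)
  then show ?case by (cases "y = x") (auto intro: converse_rtrancl_into_rtrancl)
qed simp

text \<open>Deleting \<open>f\<close> frees a place at its tail. A walk to that tail, cut at its
  first visit there, does not use \<open>f\<close> and so remains available for shifting in
  \<open>g\<close>.\<close>

lemma exchange_orientation:
  assumes "orient B t" "g \<in> E - B" "z \<in> en g" "f \<in> B"
    and "(z, t f) \<in> (arcs B t \<inter> P \<times> UNIV)\<^sup>*"
  obtains t' where "orient (insert g (B - {f})) t'"
    "\<And>v. card (outs (insert g (B - {f})) t' v) = card (outs B t v)"
    "\<And>e. e \<in> B - {f} \<Longrightarrow> t e \<notin> P \<Longrightarrow> t' e = t e"
proof -
  have BE: "B \<subseteq> E" using assms(1) by (simp add: orient_def)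
  have "arcs B t \<inter> P \<times> UNIV \<inter> {(p, q). p \<noteq> t f} \<subseteq> arcs (B - {f}) t \<inter> P \<times> UNIV"
    by (auto simp: arcs_def)
  then have "(z, t f) \<in> (arcs (B - {f}) t \<inter> P \<times> UNIV)\<^sup>*"
    using reach_avoiding_target[OF assms(5)] rtrancl_mono by blast
  moreover have "orient (B - {f}) t" using assms(1) by (auto simp: orient_def)
  moreover have "g \<in> E - (B - {f})" using assms(2) by auto
  ultimately obtain t' where t': "orient (insert g (B - {f})) t'"
    "\<And>v. card (outs (insert g (B - {f})) t' v)
      = card (outs (B - {f}) t v) + (if v = t f then 1 else 0)"
    "\<And>e. e \<in> B - {f} \<Longrightarrow> t e \<notin> P \<Longrightarrow> t' e = t e"
    using shift_orientation[of "B - {f}" t g z "t f" P] assms(3) by blast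
  have "card (outs (B - {f}) t v) + (if v = t f then 1 else 0) = card (outs B t v)" for v
  proof -
    have out: "outs (B - {f}) t v = (if v = t f then outs B t v - {f} else outs B t v)"
      by (auto simp: outs_def)
    have "f \<in> outs B t (t f)" using assms(4) by (auto simp: outs_def)
    then show ?thesis unfolding out
      using finite_outs[OF BE] card_Suc_Diff1[of "outs B t (t f)" f] by auto
  qed
  then show thesis using that[OF t'(1)] t'(2,3) by simp
qed

subsection \<open>Extremal explorations\<close>

definition admissible :: "nat \<Rightarrow> 'e set \<Rightarrow> ('e \<Rightarrow> 'v) \<Rightarrow> bool" where
  "admissible k B t \<longleftrightarrow> orient B t \<and> (\<forall>v. card (outs B t v) \<le> k) \<and> forest (E - B)"

text \<open>An exploration is recorded by the vertices through which the successive components of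
  the forest \<open>E - B\<close> are entered.\<close>

definition exploration :: "nat \<Rightarrow> 'e set \<Rightarrow> ('e \<Rightarrow> 'v) \<Rightarrow> 'v list \<Rightarrow> bool" where
  "exploration M B t ws \<longleftrightarrow> ws \<noteq> [] \<and> set ws \<subseteq> V \<and> csize (E - B) (ws ! 0) = M \<and>
     (\<forall>i j. i < j \<longrightarrow> j < length ws \<longrightarrow> (ws ! i, ws ! j) \<notin> conn (E - B)) \<and>
     (\<forall>i. 0 < i \<longrightarrow> i < length ws \<longrightarrow>
        (\<exists>j<i. \<exists>z. (ws ! j, z) \<in> conn (E - B) \<and> (z, ws ! i) \<in> arcs B t))"

definition max_verts :: "nat \<Rightarrow> 'e set \<Rightarrow> 'v set" where
  "max_verts M B = {v \<in> V. csize (E - B) v = M}"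

text \<open>The padding \<open>M + 1\<close> exceeds every component size, so that prolonging an exploration
  makes its profile lexicographically smaller.\<close>

definition profile :: "nat \<Rightarrow> 'e set \<Rightarrow> 'v list \<Rightarrow> nat list" where
  "profile M B ws =
     map (\<lambda>i. if i < length ws then csize (E - B) (ws ! i) else M + 1) [0..<card V]"

abbreviation rank :: "nat \<Rightarrow> 'e set \<Rightarrow> 'v list \<Rightarrow> nat \<times> nat list" where
  "rank M B ws \<equiv> (card (max_verts M B), profile M B ws)"

abbreviation rank_less :: "((nat \<times> nat list) \<times> nat \<times> nat list) set" where
  "rank_less \<equiv> less_than <*lex*> lex less_than"

lemma lex_less_thanI:
  assumes "length xs = length ys" "i < length xs" "\<And>j. j < i \<Longrightarrow> xs ! j = ys ! j"
    and "xs ! i < (ys ! i :: nat)"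
  shows "(xs, ys) \<in> lex less_than"
proof -
  have "take i xs = take i ys" using assms by (intro nth_equalityI) auto
  then have "xs = take i ys @ xs ! i # drop (Suc i) xs" "ys = take i ys @ ys ! i # drop (Suc i) ys"
    using assms id_take_nth_drop[of i xs] id_take_nth_drop[of i ys] by auto
  moreover have "(xs ! i, ys ! i) \<in> less_than" using assms(4) by simp
  ultimately show ?thesis
    unfolding lex_conv mem_Collect_eq case_prod_conv using assms(1) by blast
qed

text \<open>Entry vertices lie in different components and are therefore distinct. Profiles of
  length \<open>card V\<close> thus record whole explorations.\<close>

lemma exploration_length:
  assumes "exploration M B t ws"
  shows "length ws \<le> card V"
proof -
  have "ws ! i \<noteq> ws ! j" if "i < j" "j < length ws" for i j
    using assms that conn_refl unfolding exploration_def by metis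
  then have "distinct ws"
    unfolding distinct_conv_nth by (metis nat_neq_iff)
  moreover have "set ws \<subseteq> V" using assms by (simp add: exploration_def)
  ultimately show ?thesis using finite_V card_mono distinct_card by metis
qed

lemma csize_pos_incident:
  assumes "csize S v > 0"
  obtains g where "g \<in> S" "v \<in> en g"
proof -
  have "cedges S v \<noteq> {}" using assms by (auto simp: csize_def)
  then obtain e u where e: "e \<in> S" "u \<in> en e" "(v, u) \<in> conn S" by (auto simp: cedges_def)
  from e(3)[unfolded conn_def] show thesis
  proof (cases rule: converse_rtranclE)
    case base
    then show thesis using e that by blast
  next
    case (step y)
    then show thesis using that by (auto simp: adj_def)
  qed
qed

lemma conn_isolated:
  assumes "(v, u) \<in> conn S" "\<And>g. g \<in> S \<Longrightarrow> v \<notin> en g"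
  shows "u = v"
  using assms(1)[unfolded conn_def]
  by (cases rule: converse_rtranclE) (use assms(2) in \<open>auto simp: adj_def\<close>)

end

text \<open>The successive extremal choices under the hypothesis \<open>d < M\<close> that is to be
  refuted: \<open>card B\<close> is maximal, \<open>M\<close> is the least bound on component sizes
  for this cardinality, and the triple of \<open>B\<close>, \<open>t\<close> and \<open>ws\<close>
  has minimal rank among all that attain both.\<close>

locale extremal = finite_mgraph G for G :: "('v, 'e) mgraph" +
  fixes k d M :: nat and B t ws
  assumes admissible: "admissible k B t"
    and card_maximal: "admissible k B' t' \<Longrightarrow> card B' \<le> card B"
    and csize_le: "v \<in> V \<Longrightarrow> csize (E - B) v \<le> M"
    and M_least: "admissible k B' t' \<Longrightarrow> card B' = card B \<Longrightarrow> \<exists>v\<in>V. M \<le> csize (E - B') v"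
    and exploration: "exploration M B t ws"
    and rank_minimal: "admissible k B' t' \<Longrightarrow> card B' = card B \<Longrightarrow>
      (\<And>v. v \<in> V \<Longrightarrow> csize (E - B') v \<le> M) \<Longrightarrow> exploration M B' t' ws' \<Longrightarrow>
      (rank M B' ws', rank M B ws) \<notin> rank_less"
    and d_less_M: "d < M"
begin

section \<open>The exchange step and the closure of extremal explorations\<close>

abbreviation "R \<equiv> E - B"

lemma orient: "orient B t" and outs_le: "card (outs B t v) \<le> k" and forest_R: "forest R"
  using admissible by (auto simp: admissible_def)

lemma B_subset: "B \<subseteq> E"
  using orient by (simp add: orient_def)

lemma R_subset: "R \<subseteq> E"
  by auto

lemma ws_in_V: "i < length ws \<Longrightarrow> ws ! i \<in> V"
  using exploration by (auto simp: exploration_def)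

lemma ws_nonempty: "0 < length ws"
  using exploration by (auto simp: exploration_def)

lemma csize_root: "csize R (ws ! 0) = M"
  using exploration by (simp add: exploration_def)

lemma ws_distinct: "i < j \<Longrightarrow> j < length ws \<Longrightarrow> (ws ! i, ws ! j) \<notin> conn R"
  using exploration by (simp add: exploration_def)

lemma ws_distinct_conn:
  assumes "i < length ws" "j < length ws" "(ws ! i, v) \<in> conn R" "(ws ! j, v) \<in> conn R"
  shows "i = j"
proof (rule ccontr)
  assume "i \<noteq> j"
  moreover have "(ws ! i, ws ! j) \<in> conn R" "(ws ! j, ws ! i) \<in> conn R"
    using assms conn_sym conn_trans by blast+
  ultimately show False using ws_distinct assms(1,2) by (meson nat_neq_iff)
qed

lemma ws_parent:
  assumes "0 < i" "i < length ws"
  obtains j z where "j < i" "(ws ! j, z) \<in> conn R" "(z, ws ! i) \<in> arcs B t"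
  using exploration assms that unfolding exploration_def by blast

text \<open>The common improvement step: \<open>f\<close> moves from \<open>B\<close> to the forest, \<open>g\<close> moves back, and the
  orientation is repaired along a path of arcs that leaves the earlier components untouched.\<close>

lemma no_improving_exchange:
  assumes i: "i < length ws"
    and f: "f \<in> B" "t f = x" "en f = {x, y}" "(x, y) \<notin> conn R"
    and g: "g \<in> R" "z \<in> en g" "(ws ! i, z) \<in> conn R"
    and path: "(z, x) \<in> (arcs B t \<inter> P \<times> UNIV)\<^sup>*"
    and P: "\<And>l v. l < i \<Longrightarrow> (ws ! l, v) \<in> conn R \<Longrightarrow> v \<notin> P"
    and x: "\<And>l. l < i \<Longrightarrow> (ws ! l, x) \<notin> conn R"
    and y: "\<And>l. l \<le> i \<Longrightarrow> (ws ! l, y) \<notin> conn R"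
    and small: "csize (R - {g}) x + csize R y + 1 < M"
    and decr: "(ws ! i, x) \<notin> conn (R - {g}) \<or>
      csize (R - {g}) x + csize R y + 1 < csize R (ws ! i)"
  shows False
proof -
  define T where "T = R - {g}"
  define B' where "B' = insert g (B - {f})"
  define R' where "R' = insert f T"
  have fE: "f \<in> E" using f B_subset by blast
  have RB': "E - B' = R'" using f g fE by (auto simp: R'_def T_def B'_def)
  have R'E: "R' \<subseteq> E" using fE by (auto simp: R'_def T_def)
  have fT: "f \<notin> T" using f by (auto simp: T_def)
  have T_R: "(p, q) \<in> conn T \<Longrightarrow> (p, q) \<in> conn R" for p q
    by (rule conn_mono) (auto simp: T_def)
  have T_R': "(p, q) \<in> conn T \<Longrightarrow> (p, q) \<in> conn R'" for p q
    by (rule conn_mono) (auto simp: R'_def)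
  have xyT: "(x, y) \<notin> conn T" using f T_R by blast
  have "forest R'"
    unfolding R'_def
    using forest_R fT f(3) xyT
    by (intro forest_insert[of T f x y] forest_subset[of R T]) (auto simp: T_def)
  moreover obtain t' where t': "orient B' t'" "\<And>v. card (outs B' t' v) = card (outs B t v)"
    "\<And>e. e \<in> B - {f} \<Longrightarrow> t e \<notin> P \<Longrightarrow> t' e = t e"
    unfolding B'_def using exchange_orientation[OF orient g(1,2) f(1), of P] path f(2) by blast
  ultimately have adm': "admissible k B' t'"
    using outs_le by (simp add: admissible_def RB')
  have "finite B" using B_subset finite_E finite_subset by blast
  then have card': "card B' = card B"
    using f(1) g(1) card_Suc_Diff1[of B f] by (simp add: B'_def)
  have g_end: "(ws ! i, u) \<in> conn R" if "u \<in> en g" for u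
    using conn_trans[OF g(3) conn_ends[OF g(1) R_subset g(2) that]] .
  have g_y: "g \<notin> cedges R y"
  proof
    assume "g \<in> cedges R y"
    then obtain u where "u \<in> en g" "(y, u) \<in> conn R" by (auto simp: cedges_def)
    then show False using g_end y[of i] conn_sym conn_trans by blast
  qed
  have g_before: "g \<notin> cedges R (ws ! l)" if "l < i" for l
  proof
    assume "g \<in> cedges R (ws ! l)"
    then obtain u where "u \<in> en g" "(ws ! l, u) \<in> conn R" by (auto simp: cedges_def)
    then show False using g_end ws_distinct_conn[of l i u] that i by auto
  qed
  have size_x: "csize R' x = csize T x + csize R y + 1"
    using csize_join[of f T x y] R'E fT f(3) xyT cedges_remove_foreign[OF g_y]
    by (simp add: R'_def T_def csize_def)
  have size_other: "csize R' v = csize T v" if "(v, x) \<notin> conn R'" for v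
    using csize_join_other[of f T x y v] that R'E fT f(3) by (simp add: R'_def)
  have TR_size: "csize T v \<le> csize R v" for v
    by (rule csize_mono) (auto simp: T_def)
  \<comment> \<open>The only component that can grow is the one containing \<open>f\<close>, and
    \<open>small\<close> keeps it below \<open>M\<close>. Hence no vertex newly enters a component
    of size \<open>M\<close>.\<close>
  have size': "csize R' v < M \<or> csize R' v \<le> csize R v" for v
    using size_x size_other[of v] TR_size[of v] small csize_cong[of v x R']
    by (cases "(v, x) \<in> conn R'") (auto simp: T_def)
  have size'_le: "csize (E - B') v \<le> M" if "v \<in> V" for v
    using size'[of v] csize_le[OF that] RB' by auto
  have max_sub: "max_verts M B' \<subseteq> max_verts M B"
    using size' csize_le by (fastforce simp: max_verts_def RB')
  \<comment> \<open>If some vertex dropped out, the one-entry exploration at a remaining vertex of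
    size \<open>M\<close> would have smaller rank, decided by the first coordinate.\<close>
  have max_eq: "max_verts M B' = max_verts M B"
  proof (rule ccontr)
    assume "max_verts M B' \<noteq> max_verts M B"
    then have less: "card (max_verts M B') < card (max_verts M B)"
      using max_sub finite_V by (intro psubset_card_mono) (auto simp: max_verts_def)
    obtain v where v: "v \<in> V" "M \<le> csize (E - B') v" using M_least[OF adm' card'] by blast
    then have "exploration M B' t' [v]" using size'_le[of v] by (simp add: exploration_def)
    then show False using rank_minimal[OF adm' card' size'_le] less by auto
  qed
  \<comment> \<open>Neither the lost edge \<open>g\<close> nor the new edge \<open>f\<close> touches
    an earlier component.\<close>
  have before: "(ws ! l, v) \<in> conn R' \<longleftrightarrow> (ws ! l, v) \<in> conn R" if "l < i" for l v
  proof
    assume "(ws ! l, v) \<in> conn R'"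
    then have "(ws ! l, v) \<in> conn T \<or> (ws ! l, x) \<in> conn T \<or> (ws ! l, y) \<in> conn T"
      using conn_insert[of "ws ! l" v f T x y] f(3) by (auto simp: R'_def)
    then show "(ws ! l, v) \<in> conn R" using T_R x[OF that] y[of l] that by auto
  next
    assume "(ws ! l, v) \<in> conn R"
    then show "(ws ! l, v) \<in> conn R'"
      using g_before[OF that] conn_remove_foreign[of g R "ws ! l" v] T_R' by (simp add: T_def)
  qed
  have size_before: "csize R' (ws ! l) = csize R (ws ! l)" if "l < i" for l
  proof -
    have "csize T (ws ! l) = csize R (ws ! l)"
      using cedges_remove_foreign[OF g_before[OF that]] by (simp add: T_def csize_def)
    moreover have "(ws ! l, x) \<notin> conn R'" using before x that by blast
    ultimately show ?thesis using size_other by simp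
  qed
  \<comment> \<open>Component \<open>i\<close> loses \<open>g\<close>. If it still contains
    \<open>x\<close>, it also absorbs the component of \<open>y\<close>, and \<open>decr\<close>
    guarantees a net loss.\<close>
  have size_i: "csize R' (ws ! i) < csize R (ws ! i)"
  proof (cases "(ws ! i, x) \<in> conn R'")
    case True
    then have "(ws ! i, x) \<in> conn T \<or> (ws ! i, y) \<in> conn T"
      using conn_insert[of "ws ! i" x f T x y] f(3) by (auto simp: R'_def)
    then have "(ws ! i, x) \<in> conn T" using T_R y[of i] by blast
    then show ?thesis using decr csize_cong[OF True] size_x by (simp add: T_def)
  next
    case False
    have "g \<in> cedges R (ws ! i)" using g by (auto simp: cedges_def)
    then show ?thesis
      using size_other[OF False] csize_remove_less[OF R_subset] by (simp add: T_def)
  qed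
  show False
  proof (cases "i = 0")
    case True
    then have "ws ! 0 \<in> max_verts M B - max_verts M B'"
      using size_i csize_root ws_in_V[OF ws_nonempty] RB' by (auto simp: max_verts_def)
    then show False using max_eq by blast
  next
    case False
    \<comment> \<open>Only the prefix up to \<open>i\<close> is kept. Its entry arcs leave
      components before \<open>i\<close>, whose vertices are outside \<open>P\<close> and different
      from \<open>x\<close>, so these arcs survive the reorientation. The sizes before
      \<open>i\<close> are unchanged and the one at \<open>i\<close> drops, which settles the
      lexicographic comparison.\<close>
    let ?ws = "take (Suc i) ws"
    have "exploration M B' t' ?ws"
      unfolding exploration_def RB'
    proof (intro conjI allI impI)
      show "?ws \<noteq> []" using ws_nonempty by auto
      show "set ?ws \<subseteq> V" using exploration set_take_subset[of "Suc i" ws]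
        by (auto simp: exploration_def)
      show "csize R' (?ws ! 0) = M" using size_before[of 0] False csize_root by simp
      fix a b assume ab: "a < b" "b < length ?ws"
      then show "(?ws ! a, ?ws ! b) \<notin> conn R'"
        using before[of a "ws ! b"] ws_distinct[of a b] i by simp
    next
      fix m assume m: "0 < m" "m < length ?ws"
      then obtain j w where j: "j < m" "(ws ! j, w) \<in> conn R" "(w, ws ! m) \<in> arcs B t"
        using ws_parent[of m] i by auto
      have ji: "j < i" using j m by simp
      obtain e where e: "e \<in> B" "t e = w" "en e = {w, ws ! m}" using j(3) by (rule arcsE)
      have "w \<noteq> x" using x[OF ji] j(2) by blast
      then have "e \<noteq> f" using e f by auto
      then have "t' e = w" "e \<in> B'" using t'(3)[of e] e P[OF ji j(2)] by (auto simp: B'_def)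
      then have "(w, ws ! m) \<in> arcs B' t'" using e(3) by (auto intro: arcsI)
      then show "\<exists>j<m. \<exists>z. (?ws ! j, z) \<in> conn R' \<and> (z, ?ws ! m) \<in> arcs B' t'"
        using j before[OF ji] m by (intro exI[of _ j] conjI exI[of _ w]) auto
    qed
    moreover have "(profile M B' ?ws, profile M B ws) \<in> lex less_than"
    proof (rule lex_less_thanI)
      have iV: "i < card V" using i exploration_length[OF exploration] by simp
      then show "i < length (profile M B' ?ws)" by (simp add: profile_def)
      show "profile M B' ?ws ! i < profile M B ws ! i"
        using iV i size_i by (simp add: profile_def RB')
      fix j assume "j < i"
      then show "profile M B' ?ws ! j = profile M B ws ! j"
        using iV i size_before by (simp add: profile_def RB')
    qed (simp add: profile_def)
    ultimately show False
      using rank_minimal[OF adm' card' size'_le] max_eq by auto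
  qed
qed

text \<open>Otherwise \<open>y\<close> could be appended to \<open>ws\<close>, replacing a padding
  entry \<open>M + 1\<close> of the profile by a size of at most \<open>M\<close>.\<close>

lemma exploration_closed:
  assumes "l < length ws" "(ws ! l, v) \<in> conn R" "(v, y) \<in> arcs B t"
  shows "\<exists>j<length ws. (ws ! j, y) \<in> conn R"
proof (rule ccontr)
  assume no: "\<not> ?thesis"
  have yV: "y \<in> V" using assms(3) B_subset arcs_in_V by blast
  let ?ws = "ws @ [y]" let ?n = "length ws"
  have "exploration M B t ?ws"
    unfolding exploration_def
  proof (intro conjI allI impI)
    show "set ?ws \<subseteq> V" using exploration yV by (simp add: exploration_def)
    show "csize R (?ws ! 0) = M" using csize_root ws_nonempty by (simp add: nth_append)
    fix a b assume "a < b" "b < length ?ws"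
    then show "(?ws ! a, ?ws ! b) \<notin> conn R"
      using ws_distinct[of a b] no by (auto simp: nth_append)
  next
    fix m assume m: "0 < m" "m < length ?ws"
    show "\<exists>j<m. \<exists>z. (?ws ! j, z) \<in> conn R \<and> (z, ?ws ! m) \<in> arcs B t"
    proof (cases "m = ?n")
      case True
      then show ?thesis using assms by (intro exI[of _ l] conjI exI[of _ v]) (auto simp: nth_append)
    next
      case False
      then obtain j z where "j < m" "(ws ! j, z) \<in> conn R" "(z, ws ! m) \<in> arcs B t"
        using ws_parent[of m] m by auto
      then show ?thesis
        using m False by (intro exI[of _ j] conjI exI[of _ z]) (auto simp: nth_append)
    qed
  qed simp
  moreover from this have "?n < card V" using exploration_length by fastforce
  then have "(profile M B ?ws, profile M B ws) \<in> lex less_than"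
    using csize_le[OF yV]
    by (intro lex_less_thanI[of _ _ ?n]) (auto simp: profile_def nth_append)
  ultimately show False using rank_minimal[OF admissible refl csize_le] by auto
qed

text \<open>In an exchange at component \<open>i\<close> this is the set \<open>P\<close> of
  permitted tails: reorienting along them keeps all other arcs out of earlier components
  intact.\<close>

definition later :: "nat \<Rightarrow> 'v set" where
  "later i = {v. \<forall>l<i. (ws ! l, v) \<notin> conn R}"

text \<open>Going back from entry vertex to entry vertex, one meets a forest edge, at the latest in the
  first component.\<close>

lemma reach_from_incident:
  assumes "0 < j" "j < length ws"
  shows "\<exists>i<j. \<exists>z g. (ws ! i, z) \<in> conn R \<and> g \<in> R \<and> z \<in> en g \<and>
    (z, ws ! j) \<in> (arcs B t \<inter> later i \<times> UNIV)\<^sup>*"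
  using assms
proof (induction j rule: less_induct)
  case (less j)
  then obtain i z where i: "i < j" "(ws ! i, z) \<in> conn R" "(z, ws ! j) \<in> arcs B t"
    using ws_parent by blast
  have iw: "i < length ws" using i less.prems by simp
  show ?case
  proof (cases "\<exists>g\<in>R. z \<in> en g")
    case True
    have "(ws ! l, z) \<notin> conn R" if "l < i" for l
      using ws_distinct_conn[of l i z] that iw i(2) by auto
    then have "z \<in> later i" by (simp add: later_def)
    then show ?thesis using i True by blast
  next
    case False
    \<comment> \<open>Without a forest edge at \<open>z\<close> its component is a single vertex, so
      the search continues backwards from the entry vertex. The root is excluded because it has more
      than \<open>d\<close> edges.\<close>
    then have z: "ws ! i = z" using conn_isolated[of z "ws ! i" R] i(2) conn_sym by blast
    have "i \<noteq> 0"
    proof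
      assume "i = 0"
      then have "csize R z > 0" using csize_root z d_less_M by simp
      then show False using False csize_pos_incident by blast
    qed
    then obtain i' z' g where i': "i' < i" "(ws ! i', z') \<in> conn R" "g \<in> R" "z' \<in> en g"
      "(z', ws ! i) \<in> (arcs B t \<inter> later i' \<times> UNIV)\<^sup>*"
      using less.IH[of i] i(1) iw by auto
    have "z \<in> later i'" using z i'(1) ws_distinct iw by (auto simp: later_def)
    then have "(z', ws ! j) \<in> (arcs B t \<inter> later i' \<times> UNIV)\<^sup>*"
      using i'(5) i(3) z by (auto intro: rtrancl_into_rtrancl)
    then show ?thesis using i' i(1) by (meson less_trans)
  qed
qed

text \<open>A vertex with a free place could absorb a forest edge: an arc walk leads to it from an
  end of some forest edge \<open>g\<close>, and shifting along this walk moves \<open>g\<close> into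
  \<open>B\<close>, against \<open>card_maximal\<close>.\<close>

lemma outs_full:
  assumes "l < length ws" "(ws ! l, v) \<in> conn R"
  shows "card (outs B t v) = k"
proof (rule ccontr)
  assume "card (outs B t v) \<noteq> k"
  then have less: "card (outs B t v) < k" using outs_le le_neq_implies_less by blast
  have "\<exists>z g. g \<in> R \<and> z \<in> en g \<and> (z, v) \<in> (arcs B t \<inter> UNIV \<times> UNIV)\<^sup>*"
  proof (cases "\<exists>g\<in>R. v \<in> en g")
    case False
    then have v: "ws ! l = v" using conn_isolated[of v "ws ! l" R] assms(2) conn_sym by blast
    have "l \<noteq> 0"
    proof
      assume "l = 0"
      then have "csize R v > 0" using csize_root v d_less_M by simp
      then show False using False csize_pos_incident by blast
    qed
    then obtain i z g where "g \<in> R" "z \<in> en g"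
      "(z, v) \<in> (arcs B t \<inter> later i \<times> UNIV)\<^sup>*"
      using reach_from_incident[of l] assms(1) v by blast
    moreover have "(arcs B t \<inter> later i \<times> UNIV)\<^sup>* \<subseteq> (arcs B t \<inter> UNIV \<times> UNIV)\<^sup>*"
      by (intro rtrancl_mono) auto
    ultimately show ?thesis by blast
  qed blast
  then obtain z g where g: "g \<in> R" "z \<in> en g" "(z, v) \<in> (arcs B t \<inter> UNIV \<times> UNIV)\<^sup>*"
    by blast
  obtain t' where t': "orient (insert g B) t'"
    "\<And>u. card (outs (insert g B) t' u) = card (outs B t u) + (if u = v then 1 else 0)"
    using shift_orientation[OF orient g] by blast
  have "card (outs (insert g B) t' u) \<le> k" for u
    using t'(2)[of u] outs_le[of u] less by auto
  moreover have "forest (E - insert g B)" by (rule forest_subset[OF forest_R]) auto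
  ultimately have "admissible k (insert g B) t'" using t'(1) by (simp add: admissible_def)
  then have "card (insert g B) \<le> card B" by (rule card_maximal)
  then show False using g(1) B_subset finite_E finite_subset by fastforce
qed

section \<open>Sizes of a component and its children\<close>

definition child_arc :: "nat \<Rightarrow> 'v \<Rightarrow> nat \<Rightarrow> bool" where
  "child_arc l x m \<longleftrightarrow> l < m \<and> m < length ws \<and> (ws ! l, x) \<in> conn R \<and> (x, ws ! m) \<in> arcs B t"

text \<open>Here the arc entering the child moves to the forest. Allowing \<open>i < l\<close>
  serves the case in which \<open>x\<close> is the entry vertex of its own component.\<close>

lemma child_arc_exchange:
  assumes "child_arc l x m" "i \<le> l" "g \<in> R" "z \<in> en g" "(ws ! i, z) \<in> conn R"
    and "(z, x) \<in> (arcs B t \<inter> later i \<times> UNIV)\<^sup>*"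
    and "csize (R - {g}) x + csize R (ws ! m) + 1 < M"
    and "(ws ! i, x) \<notin> conn (R - {g}) \<or>
      csize (R - {g}) x + csize R (ws ! m) + 1 < csize R (ws ! i)"
  shows False
proof -
  have l: "l < m" "m < length ws" "(ws ! l, x) \<in> conn R" using assms(1) by (auto simp: child_arc_def)
  obtain f where f: "f \<in> B" "t f = x" "en f = {x, ws ! m}"
    using assms(1) by (auto simp: child_arc_def elim: arcsE)
  show False
  proof (rule no_improving_exchange[OF _ f _ assms(3-6) _ _ _ assms(7,8)])
    show "i < length ws" using l assms(2) by simp
    show "(x, ws ! m) \<notin> conn R" using l ws_distinct conn_trans by blast
    show "v \<notin> later i" if "l' < i" "(ws ! l', v) \<in> conn R" for l' v
      using that by (auto simp: later_def)
    show "(ws ! l', x) \<notin> conn R" if "l' < i" for l'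
      using that assms(2) l ws_distinct_conn[of l' l x] by auto
    show "(ws ! l', ws ! m) \<notin> conn R" if "l' \<le> i" for l'
      using that assms(2) l ws_distinct by auto
  qed
qed

text \<open>Trading the branch beyond \<open>g\<close> for a smaller child would shrink the
  component of \<open>x\<close>, an improvement.\<close>

lemma child_branch:
  assumes "child_arc l x m" "g \<in> R" "en g = {x, a}"
  shows "csize (R - {g}) a \<le> csize R (ws ! m)"
proof (rule ccontr)
  assume less: "\<not> ?thesis"
  have l: "l < m" "m < length ws" "(ws ! l, x) \<in> conn R" using assms(1) by (auto simp: child_arc_def)
  have "(x, a) \<notin> conn (R - {g})" using forest_R assms by (auto simp: forest_def)
  then have "csize R x = csize (R - {g}) x + csize (R - {g}) a + 1"
    using csize_bridge[OF R_subset assms(2,3)] by blast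
  moreover have "csize R x \<le> M" using csize_le l ws_in_V[of l] conn_in_V[OF l(3) R_subset] by simp
  moreover have "csize R (ws ! l) = csize R x" using csize_cong l(3) by blast
  ultimately show False
    using child_arc_exchange[OF assms(1) order_refl assms(2), of x] assms(3) l(3) less by auto
qed

text \<open>Exchanging an edge that separates \<open>x\<close> from the entry vertex shrinks
  component \<open>l\<close> in any case; only a new component of size at least \<open>M\<close>
  prevents an improvement.\<close>

lemma child_cut:
  assumes "child_arc l x m" "g \<in> R" "x \<in> en g" "(ws ! l, x) \<notin> conn (R - {g})"
  shows "M \<le> csize (R - {g}) x + csize R (ws ! m) + 1"
proof (rule ccontr)
  assume "\<not> ?thesis"
  moreover have "(ws ! l, x) \<in> conn R" using assms(1) by (simp add: child_arc_def)
  ultimately show False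
    using child_arc_exchange[OF assms(1) order_refl assms(2,3)] assms(4) by simp
qed

text \<open>The root alone has more than \<open>d\<close> edges. Elsewhere there is an exchange
  whose new component has at most the edges of both components and one more, and this number must
  reach \<open>M > d\<close>.\<close>

lemma child_csize:
  assumes "child_arc l x m"
  shows "d \<le> csize R (ws ! l) + csize R (ws ! m)"
proof -
  have l: "l < m" "m < length ws" "(ws ! l, x) \<in> conn R" using assms by (auto simp: child_arc_def)
  \<comment> \<open>If \<open>x\<close> is not the entry vertex, the edge at \<open>x\<close>
    towards it is exchanged. If it is, an edge of an earlier component is used, found by going back
    along arcs.\<close>
  consider "l = 0" | "x \<noteq> ws ! l" | "0 < l" "x = ws ! l" by blast
  then show ?thesis
  proof cases
    case 1
    then show ?thesis using csize_root d_less_M by simp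
  next
    case 2
    then obtain g a where g: "g \<in> R" "en g = {x, a}" "(x, ws ! l) \<notin> conn (R - {g})"
      using forest_bridge_towards[OF forest_R conn_sym[OF l(3)]] by blast
    have "M \<le> csize (R - {g}) x + csize R (ws ! m) + 1"
      using child_cut[OF assms g(1)] g conn_sym by blast
    moreover have "csize (R - {g}) x \<le> csize R x" by (rule csize_mono) auto
    ultimately show ?thesis using csize_cong[OF l(3)] d_less_M by simp
  next
    case 3
    then obtain i z g where i: "i < l" "(ws ! i, z) \<in> conn R" "g \<in> R" "z \<in> en g"
      "(z, x) \<in> (arcs B t \<inter> later i \<times> UNIV)\<^sup>*"
      using reach_from_incident[of l] l by auto
    have "(ws ! i, x) \<notin> conn R" using 3 i l ws_distinct by auto
    then have "(ws ! i, x) \<notin> conn (R - {g})" using conn_mono[of _ _ "R - {g}" R] by blast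
    then have "M \<le> csize (R - {g}) x + csize R (ws ! m) + 1"
      using child_arc_exchange[OF assms _ i(3,4,2,5)] i(1) by force
    moreover have "csize (R - {g}) x \<le> csize R x" by (rule csize_mono) auto
    ultimately show ?thesis using 3 d_less_M by simp
  qed
qed

text \<open>The side of \<open>x1\<close> cut off by \<open>g1\<close> lies within the branch at
  \<open>x2\<close> beyond \<open>g2\<close>, which is no larger than the child \<open>m2\<close> by
  \<open>child_branch\<close>. Together with the child \<open>m1\<close> and one edge it must reach
  \<open>M\<close> by \<open>child_cut\<close>.\<close>

lemma two_child_vertices_aux:
  assumes "child_arc l x1 m1" "child_arc l x2 m2"
    and g1: "g1 \<in> R" "en g1 = {x1, a1}" "(x1, x2) \<notin> conn (R - {g1})"
      "(ws ! l, x1) \<notin> conn (R - {g1})"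
    and g2: "g2 \<in> R" "en g2 = {x2, a2}" "(x1, x2) \<notin> conn (R - {g2})"
  shows "d \<le> csize R (ws ! m1) + csize R (ws ! m2)"
proof -
  have "(x1, x2) \<in> conn R"
    using assms(1,2) conn_sym conn_trans unfolding child_arc_def by blast
  then have a2: "(x1, a2) \<in> conn (R - {g2})" using conn_remove g2 by blast
  have "g2 \<notin> cedges (R - {g1}) x1"
  proof
    assume "g2 \<in> cedges (R - {g1}) x1"
    then obtain u where u: "g2 \<in> R - {g1}" "u \<in> en g2" "(x1, u) \<in> conn (R - {g1})"
      by (auto simp: cedges_def)
    moreover have "(u, x2) \<in> conn (R - {g1})"
      using u g2(2) by (intro conn_ends[of g2]) auto
    ultimately show False using g1(3) conn_trans by blast
  qed
  then have "csize (R - {g1}) x1 = csize (R - {g1} - {g2}) x1"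
    using cedges_remove_foreign by (simp add: csize_def)
  also have "\<dots> \<le> csize (R - {g2}) x1" by (rule csize_mono) auto
  also have "\<dots> = csize (R - {g2}) a2" using csize_cong a2 by blast
  also have "\<dots> \<le> csize R (ws ! m2)" using child_branch[OF assms(2) g2(1,2)] .
  finally show ?thesis using child_cut[OF assms(1) g1(1) _ g1(4)] g1(2) d_less_M by simp
qed

lemma two_child_vertices:
  assumes "child_arc l x1 m1" "child_arc l x2 m2" "x1 \<noteq> x2"
  shows "d \<le> csize R (ws ! m1) + csize R (ws ! m2)"
proof -
  have x12: "(x1, x2) \<in> conn R"
    using assms(1,2) conn_sym conn_trans unfolding child_arc_def by blast
  obtain g1 a1 where g1: "g1 \<in> R" "en g1 = {x1, a1}" "(x1, x2) \<notin> conn (R - {g1})"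
    using forest_bridge_towards[OF forest_R x12 assms(3)] by blast
  obtain g2 a2 where g2: "g2 \<in> R" "en g2 = {x2, a2}" "(x2, x1) \<notin> conn (R - {g2})"
    using forest_bridge_towards[OF forest_R conn_sym[OF x12]] assms(3) by metis
  \<comment> \<open>The side of \<open>x1\<close> without \<open>g1\<close> does not contain
    \<open>g2\<close>. If both connections existed, the one from \<open>x1\<close> to the entry
    vertex would therefore avoid \<open>g2\<close> and, continued to \<open>x2\<close>, would join
    \<open>x1\<close> to \<open>x2\<close> without \<open>g2\<close>.\<close>
  have "(ws ! l, x1) \<notin> conn (R - {g1}) \<or> (ws ! l, x2) \<notin> conn (R - {g2})"
  proof (rule ccontr)
    assume "\<not> ?thesis"
    then have c: "(x1, ws ! l) \<in> conn (R - {g1})" "(ws ! l, x2) \<in> conn (R - {g2})"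
      using conn_sym by blast+
    have "g2 \<notin> cedges (R - {g1}) x1"
    proof
      assume "g2 \<in> cedges (R - {g1}) x1"
      then obtain u where u: "g2 \<in> R - {g1}" "u \<in> en g2" "(x1, u) \<in> conn (R - {g1})"
        by (auto simp: cedges_def)
      moreover have "(u, x2) \<in> conn (R - {g1})"
        using u g2(2) by (intro conn_ends[of g2]) auto
      ultimately show False using g1(3) conn_trans by blast
    qed
    then have "(x1, ws ! l) \<in> conn (R - {g1} - {g2})" using conn_remove_foreign c(1) by blast
    then have "(x1, ws ! l) \<in> conn (R - {g2})" by (rule conn_mono) auto
    then show False using c(2) g2(3) conn_sym conn_trans by blast
  qed
  then show ?thesis
    using two_child_vertices_aux[OF assms(1,2) g1 _ g2(1,2)]
      two_child_vertices_aux[OF assms(2,1) g2 _ g1(1,2)] g1(3) g2(3) conn_sym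
    by (metis add.commute)
qed

subsection \<open>Counting\<close>

text \<open>The density bound on the explored vertex set forces an average component size of at most
  \<open>d / (k + 1)\<close>, whereas grouping small components with their parents shows that the
  average is larger.\<close>

lemma density_contradiction:
  assumes "1 \<le> k"
    and density: "\<And>X S. X \<subseteq> V \<Longrightarrow> X \<noteq> {} \<Longrightarrow> S \<subseteq> E \<Longrightarrow> (\<And>e. e \<in> S \<Longrightarrow> en e \<subseteq> X) \<Longrightarrow>
      card S * (d + k + 1) \<le> (k * (d + k + 1) + d) * card X"
  shows False
proof -
  define n where "n = length ws"
  define s where "s l = csize R (ws ! l)" for l
  define small where "small l \<longleftrightarrow> (k + 1) * s l < d" for l
  define H where "H = (\<Union>l<n. {v. (ws ! l, v) \<in> conn R})"
  \<comment> \<open>Both sets stay inside \<open>H\<close>: the arcs because the exploration is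
    closed, the forest edges because \<open>H\<close> is a union of components.\<close>
  let ?S1 = "{e \<in> B. t e \<in> H}" and ?S2 = "\<Union>l<n. cedges R (ws ! l)"
  have HV: "H \<subseteq> V"
    using conn_in_V R_subset ws_in_V by (auto simp: H_def n_def)
  have finH: "finite H" using HV finite_V finite_subset by blast
  have "ws ! 0 \<in> H" using ws_nonempty conn_refl[of "ws ! 0" R] unfolding H_def n_def by blast
  then have H_ne: "H \<noteq> {}" by blast
  have "card ?S1 = k * card H"
  proof -
    have "?S1 = (\<Union>v\<in>H. outs B t v)" by (auto simp: outs_def)
    also have "card \<dots> = (\<Sum>v\<in>H. card (outs B t v))"
      using finH finite_outs[OF B_subset] by (intro card_UN_disjoint) (auto simp: outs_def)
    also have "\<dots> = (\<Sum>v\<in>H. k)"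
      using outs_full by (intro sum.cong) (auto simp: H_def n_def)
    finally show ?thesis by simp
  qed
  moreover have "card ?S2 = (\<Sum>l<n. s l)"
    unfolding s_def csize_def
  proof (rule card_UN_disjoint)
    show "\<forall>i\<in>{..<n}. \<forall>j\<in>{..<n}. i \<noteq> j \<longrightarrow> cedges R (ws ! i) \<inter> cedges R (ws ! j) = {}"
    proof (intro ballI impI, rule ccontr)
      fix i j assume ij: "i \<in> {..<n}" "j \<in> {..<n}" "i \<noteq> j"
        "cedges R (ws ! i) \<inter> cedges R (ws ! j) \<noteq> {}"
      then obtain e u u' where e: "e \<in> R" "u \<in> en e" "u' \<in> en e"
        "(ws ! i, u) \<in> conn R" "(ws ! j, u') \<in> conn R"
        by (auto simp: cedges_def)
      have "(ws ! j, u) \<in> conn R"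
        using conn_trans[OF e(5) conn_ends[OF e(1) R_subset e(3,2)]] .
      then show False using ws_distinct_conn[of i j u] e(4) ij by (auto simp: n_def)
    qed
  qed (use finite_cedges[OF R_subset] in auto)
  moreover have "card (?S1 \<union> ?S2) = card ?S1 + card ?S2"
    using finite_cedges[OF R_subset] cedges_subset[of R] finite_subset[OF B_subset finite_E]
    by (intro card_Un_disjoint) auto
  ultimately have card_S: "card (?S1 \<union> ?S2) = k * card H + (\<Sum>l<n. s l)" by simp
  have "card (?S1 \<union> ?S2) * (d + k + 1) \<le> (k * (d + k + 1) + d) * card H"
  proof (rule density[OF HV H_ne])
    show "?S1 \<union> ?S2 \<subseteq> E" using B_subset cedges_subset[of R] by auto
    fix e assume "e \<in> ?S1 \<union> ?S2"
    then consider (blue) "e \<in> B" "t e \<in> H" | (red) l where "l < n" "e \<in> cedges R (ws ! l)" by blast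
    then show "en e \<subseteq> H"
    proof cases
      case blue
      then obtain l where l: "l < n" "(ws ! l, t e) \<in> conn R" by (auto simp: H_def)
      have "t e \<in> en e" using blue(1) orient by (simp add: orient_def)
      then obtain y where y: "en e = {t e, y}" using blue(1) B_subset ends_pair by blast
      then have "(t e, y) \<in> arcs B t" using blue(1) by (auto intro: arcsI)
      then have "y \<in> H" using exploration_closed[of l] l by (auto simp: H_def n_def)
      then show ?thesis using y blue by simp
    next
      case red
      then obtain u where u: "e \<in> R" "u \<in> en e" "(ws ! l, u) \<in> conn R" by (auto simp: cedges_def)
      then have "(ws ! l, v) \<in> conn R" if "v \<in> en e" for v
        using conn_trans[OF u(3) conn_ends[OF u(1) R_subset u(2) that]] by simp
      then show ?thesis using red(1) by (auto simp: H_def)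
    qed
  qed
  \<comment> \<open>The arcs account exactly for the summand with factor \<open>k\<close>, which
    cancels. A component has at most one vertex more than edges, so \<open>card H\<close> can then
    be replaced by the total size plus \<open>n\<close>.\<close>
  then have "(\<Sum>l<n. s l) * (d + k + 1) \<le> d * card H"
    unfolding card_S by (simp add: algebra_simps)
  also have "d * card H \<le> d * ((\<Sum>l<n. s l) + n)"
  proof (rule mult_le_mono2)
    have "card H \<le> (\<Sum>l<n. card {v. (ws ! l, v) \<in> conn R})"
      unfolding H_def by (rule card_UN_le) simp
    also have "\<dots> \<le> (\<Sum>l<n. s l + 1)"
      unfolding s_def using card_component_le[OF R_subset forest_R] ws_in_V
      by (intro sum_mono) (auto simp: n_def)
    finally show "card H \<le> (\<Sum>l<n. s l) + n" by (simp only: sum.distrib) simp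
  qed
  finally have upper: "(k + 1) * (\<Sum>l<n. s l) \<le> d * n" by (simp add: algebra_simps)

  have "\<exists>l x. child_arc l x m" if "0 < m" "m < n" for m
    using ws_parent[of m] that unfolding child_arc_def n_def by metis
  then obtain par pv where par: "\<And>m. 0 < m \<Longrightarrow> m < n \<Longrightarrow> child_arc (par m) (pv m) m"
    by metis
  have s0: "d < s 0" using csize_root d_less_M by (simp add: s_def)
  have small_pos: "0 < m" if "small m" for m
  proof (rule ccontr)
    assume "\<not> 0 < m"
    then have "s 0 < d" using that by (simp add: small_def)
    then show False using s0 by simp
  qed
  \<comment> \<open>Two sizes below \<open>d / (k + 1)\<close> add up to less than
    \<open>2 * d / (k + 1)\<close>, which is at most \<open>d\<close> because
    \<open>k \<ge> 1\<close>.\<close>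
  have not_both: False if "small l" "small m" "d \<le> s l + s m" for l m
  proof -
    have "2 * d \<le> (k + 1) * d" using assms(1) by (intro mult_le_mono1) simp
    also have "\<dots> \<le> (k + 1) * (s l + s m)" using that(3) by (rule mult_le_mono2)
    also have "\<dots> < 2 * d" using that(1,2) unfolding small_def by (simp add: algebra_simps)
    finally show False by simp
  qed
  \<comment> \<open>The groups for the averaging: a component that is not small together with the
    small components assigned to it as parent.\<close>
  define q where "q l = (if small l then par l else l)" for l
  define T where "T = {l. l < n \<and> \<not> small l}"
  define Ch where "Ch p = {m. m < n \<and> small m \<and> par m = p}" for p
  have child: "child_arc p (pv m) m" if "m \<in> Ch p" for p m
    using that par[of m] small_pos by (auto simp: Ch_def)
  \<comment> \<open>By \<open>two_child_vertices\<close> all small children of \<open>p\<close> are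
    entered from one vertex, and they use different arcs out of it.\<close>
  have card_Ch: "card (Ch p) \<le> k" for p
  proof (cases "Ch p = {}")
    case False
    then obtain m0 where m0: "m0 \<in> Ch p" by blast
    have same: "pv m = pv m0" if "m \<in> Ch p" for m
    proof (rule ccontr)
      assume "pv m \<noteq> pv m0"
      then have "d \<le> s m + s m0"
        using two_child_vertices child[OF that] child[OF m0] by (simp add: s_def)
      then show False using not_both that m0 by (auto simp: Ch_def)
    qed
    have "\<exists>e. e \<in> outs B t (pv m0) \<and> en e = {pv m0, ws ! m}" if "m \<in> Ch p" for m
      using child[OF that] same[OF that] by (auto simp: child_arc_def outs_def elim!: arcsE)
    then obtain fe where fe: "\<And>m. m \<in> Ch p \<Longrightarrow>
        fe m \<in> outs B t (pv m0) \<and> en (fe m) = {pv m0, ws ! m}"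
      by metis
    have "inj_on fe (Ch p)"
    proof (rule inj_onI)
      fix m m' assume m: "m \<in> Ch p" "m' \<in> Ch p" "fe m = fe m'"
      then have "{pv m0, ws ! m} = {pv m0, ws ! m'}" using fe by metis
      then have "ws ! m = ws ! m'" by (auto simp: doubleton_eq_iff)
      then show "m = m'"
        using m ws_distinct_conn[of m m' "ws ! m"] by (simp add: Ch_def n_def)
    qed
    then have "card (Ch p) \<le> card (outs B t (pv m0))"
      using fe finite_outs[OF B_subset] by (intro card_inj_on_le[of fe]) auto
    then show ?thesis using outs_le le_trans by blast
  qed simp
  have finCh: "finite (Ch p)" for p by (auto simp: Ch_def)
  \<comment> \<open>This is \<open>k + 1\<close> times the excess of a size over
    \<open>d / (k + 1)\<close>, taken in the integers because it may be negative.\<close>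
  define val where "val l = int ((k + 1) * s l) - int d" for l
  define F where "F p = (\<Sum>l \<in> {l \<in> {..<n}. q l = p}. val l)" for p
  \<comment> \<open>If there is a small child, it and \<open>p\<close> together already have
    \<open>d\<close> edges, while a group of at most \<open>k + 1\<close> components needs only
    \<open>d\<close> to meet the average. Strictness at the root comes from
    \<open>d < s 0\<close>.\<close>
  have F_bound: "0 \<le> F p \<and> (p = 0 \<longrightarrow> 0 < F p)" if "p \<in> T" for p
  proof -
    have p: "p < n" "\<not> small p" using that by (auto simp: T_def)
    have "{l \<in> {..<n}. q l = p} = insert p (Ch p)" using p by (auto simp: q_def Ch_def split: if_splits)
    moreover have "p \<notin> Ch p" using p by (simp add: Ch_def)
    ultimately have "F p = val p + (\<Sum>m\<in>Ch p. val m)" using finCh by (simp add: F_def)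
    then have F: "F p = int ((k + 1) * (s p + (\<Sum>m\<in>Ch p. s m))) - int (d * (card (Ch p) + 1))"
      by (simp add: val_def sum_subtractf sum_distrib_left algebra_simps sum.distrib)
    show ?thesis
    proof (cases "Ch p = {}")
      case True
      have "d < (k + 1) * s 0" using s0 by simp
      then show ?thesis using F True p(2) by (auto simp: small_def simp flip: of_nat_mult)
    next
      case False
      then obtain m where m: "m \<in> Ch p" by blast
      have "s m \<le> (\<Sum>m\<in>Ch p. s m)" using m finCh by (intro member_le_sum) auto
      moreover have "d \<le> s p + s m" using child_csize[OF child[OF m]] by (simp add: s_def)
      ultimately have *: "d \<le> s p + (\<Sum>m\<in>Ch p. s m)" "p = 0 \<Longrightarrow> d < s p + (\<Sum>m\<in>Ch p. s m)"
        using s0 by auto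
      have le: "d * (card (Ch p) + 1) \<le> (k + 1) * d" using card_Ch[of p] by simp
      also have "\<dots> \<le> (k + 1) * (s p + (\<Sum>m\<in>Ch p. s m))" using *(1) by (rule mult_le_mono2)
      finally have "0 \<le> F p" unfolding F by linarith
      moreover have "0 < F p" if "p = 0"
      proof -
        have "(k + 1) * d < (k + 1) * (s p + (\<Sum>m\<in>Ch p. s m))"
          using *(2)[OF that] by (intro mult_less_mono2) auto
        then show ?thesis unfolding F using le by linarith
      qed
      ultimately show ?thesis by blast
    qed
  qed
  \<comment> \<open>By \<open>child_csize\<close> the parent of a small component is not small, so
    the groups cover every index.\<close>
  have "q ` {..<n} \<subseteq> T"
  proof (rule image_subsetI)
    fix m assume "m \<in> {..<n}"
    then have m: "m < n" by simp
    show "q m \<in> T"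
    proof (cases "small m")
      case True
      then have c: "child_arc (par m) (pv m) m" using par small_pos m by blast
      then have "d \<le> s (par m) + s m" using child_csize by (simp add: s_def)
      then have "\<not> small (par m)" using not_both True by blast
      moreover have "par m < n" using c m by (simp add: child_arc_def)
      ultimately show ?thesis using True by (simp add: q_def T_def)
    qed (use m in \<open>simp add: q_def T_def\<close>)
  qed
  moreover have finT: "finite T" by (simp add: T_def)
  ultimately have "(\<Sum>l<n. val l) = (\<Sum>p\<in>T. F p)"
    unfolding F_def by (subst sum.group) auto
  also have "\<dots> > 0"
  proof (rule sum_pos2[OF finT])
    show "0 \<in> T" using small_pos ws_nonempty by (auto simp: T_def n_def)
    then show "0 < F 0" using F_bound by blast
  qed (use F_bound in blast)
  finally have "0 < (\<Sum>l<n. val l)" .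
  moreover have "(\<Sum>l<n. val l) = int ((k + 1) * (\<Sum>l<n. s l)) - int (d * n)"
    by (simp add: val_def sum_subtractf sum_distrib_left sum.distrib algebra_simps)
  ultimately show False using upper by linarith
qed

end

subsection \<open>Existence of an extremal decomposition\<close>

context finite_mgraph
begin

text \<open>Otherwise the set reachable from \<open>v\<close> is closed under arcs and all its
  outdegrees exceed \<open>k\<close>, so it spans too many edges.\<close>

lemma reaches_deficient:
  assumes density: "\<And>X S. X \<subseteq> V \<Longrightarrow> X \<noteq> {} \<Longrightarrow> S \<subseteq> E \<Longrightarrow> (\<And>e. e \<in> S \<Longrightarrow> en e \<subseteq> X) \<Longrightarrow>
      card S < (k + 1) * card X"
    and "orient B t" "v \<in> V"
  shows "\<exists>u. (v, u) \<in> (arcs B t)\<^sup>* \<and> card (outs B t u) \<le> k"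
proof (rule ccontr)
  assume no: "\<not> ?thesis"
  let ?U = "{u. (v, u) \<in> (arcs B t)\<^sup>*}"
  have BE: "B \<subseteq> E" using assms(2) by (simp add: orient_def)
  have UV: "?U \<subseteq> V" using reach_in_V[OF _ BE] assms(3) by blast
  then have finU: "finite ?U" using finite_V finite_subset by blast
  have "card {e \<in> B. t e \<in> ?U} = card (\<Union>u\<in>?U. outs B t u)"
    by (rule arg_cong[where f = card]) (auto simp: outs_def)
  also have "\<dots> = (\<Sum>u\<in>?U. card (outs B t u))"
    using finU finite_outs[OF BE] by (intro card_UN_disjoint) (auto simp: outs_def)
  also have "\<dots> \<ge> (\<Sum>u\<in>?U. k + 1)" using no by (intro sum_mono) force
  finally have "(k + 1) * card ?U \<le> card {e \<in> B. t e \<in> ?U}" by (simp add: mult.commute)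
  moreover have "card {e \<in> B. t e \<in> ?U} < (k + 1) * card ?U"
  proof (rule density[OF UV])
    show "?U \<noteq> {}" by blast
    show "{e \<in> B. t e \<in> ?U} \<subseteq> E" using BE by blast
    fix e assume e: "e \<in> {e \<in> B. t e \<in> ?U}"
    then have "t e \<in> en e" using assms(2) by (simp add: orient_def)
    then obtain y where y: "en e = {t e, y}" using e BE ends_pair by blast
    then have "(t e, y) \<in> arcs B t" using e by (auto intro: arcsI)
    then have "y \<in> ?U" using e by (auto intro: rtrancl_into_rtrancl)
    then show "en e \<subseteq> ?U" using y e by simp
  qed
  ultimately show False by simp
qed

text \<open>A form of Hakimi's orientation theorem: edges are inserted one at a time, and the
  surplus is shifted along arcs to a vertex with a free place.\<close>

lemma exists_orientation:
  assumes density: "\<And>X S. X \<subseteq> V \<Longrightarrow> X \<noteq> {} \<Longrightarrow> S \<subseteq> E \<Longrightarrow> (\<And>e. e \<in> S \<Longrightarrow> en e \<subseteq> X) \<Longrightarrow>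
      card S < (k + 1) * card X"
  obtains t where "orient E t" "\<And>v. card (outs E t v) \<le> k + 1"
proof -
  have "\<exists>t. orient B t \<and> (\<forall>v. card (outs B t v) \<le> k + 1)" if "finite B" "B \<subseteq> E" for B
    using that
  proof (induction B rule: finite_induct)
    case empty
    then show ?case by (simp add: orient_def outs_def)
  next
    case (insert e B)
    then obtain t where t: "orient B t" "\<And>v. card (outs B t v) \<le> k + 1" by auto
    obtain z where z: "z \<in> en e" using insert.prems ends_nonempty by blast
    then have "z \<in> V" using insert.prems ends_subset by blast
    then obtain u where u: "(z, u) \<in> (arcs B t)\<^sup>*" "card (outs B t u) \<le> k"
      using reaches_deficient[OF density t(1)] by blast
    have eB: "e \<in> E - B" using insert by auto
    obtain t' where t': "orient (insert e B) t'"
      "\<And>v. card (outs (insert e B) t' v) = card (outs B t v) + (if v = u then 1 else 0)"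
      using shift_orientation[OF t(1) eB z, of u UNIV] u(1) by auto
    have "card (outs (insert e B) t' v) \<le> k + 1" for v
      using t'(2)[of v] t(2)[of v] u(2) by auto
    then show ?case using t'(1) by blast
  qed
  then show thesis using that finite_E by blast
qed

text \<open>Each vertex of full outdegree gives up the first arc of a shortest path to a deficient
  vertex; distances to the deficient vertices drop along these arcs, so they form a forest.\<close>

lemma exists_admissible:
  assumes density: "\<And>X S. X \<subseteq> V \<Longrightarrow> X \<noteq> {} \<Longrightarrow> S \<subseteq> E \<Longrightarrow> (\<And>e. e \<in> S \<Longrightarrow> en e \<subseteq> X) \<Longrightarrow>
      card S < (k + 1) * card X"
  shows "\<exists>B t. admissible k B t"
proof -
  obtain t where t: "orient E t" "\<And>v. card (outs E t v) \<le> k + 1"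
    using exists_orientation[OF density] by blast
  define reach where
    "reach v n \<longleftrightarrow> (\<exists>u. (v, u) \<in> arcs E t ^^ n \<and> card (outs E t u) \<le> k)" for v n
  define \<delta> where "\<delta> v = (LEAST n. reach v n)" for v
  define D where "D = {v \<in> V. \<not> card (outs E t v) \<le> k}"
  have "\<exists>e w. e \<in> E \<and> t e = v \<and> en e = {v, w} \<and> \<delta> w < \<delta> v" if "v \<in> D" for v
  proof -
    have v: "v \<in> V" "\<not> card (outs E t v) \<le> k" using that by (auto simp: D_def)
    obtain u where "(v, u) \<in> (arcs E t)\<^sup>*" "card (outs E t u) \<le> k"
      using reaches_deficient[OF density t(1) v(1)] by blast
    then have "\<exists>n. reach v n" unfolding reach_def using rtrancl_imp_relpow by blast
    then have "reach v (\<delta> v)" unfolding \<delta>_def by (rule LeastI_ex)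
    then obtain u where u: "(v, u) \<in> arcs E t ^^ \<delta> v" "card (outs E t u) \<le> k"
      by (auto simp: reach_def)
    then have "\<delta> v \<noteq> 0" using v(2) by (metis relpow_0_E)
    then obtain m where m: "\<delta> v = Suc m" using not0_implies_Suc by blast
    then obtain w where w: "(v, w) \<in> arcs E t" "(w, u) \<in> arcs E t ^^ m"
      using u(1) relpow_Suc_D2 by metis
    then have "reach w m" using u(2) by (auto simp: reach_def)
    then have "\<delta> w \<le> m" unfolding \<delta>_def by (rule Least_le)
    then have "\<delta> w < \<delta> v" using m by simp
    then show ?thesis using w(1) by (auto elim!: arcsE)
  qed
  then obtain ed nx where ed: "\<And>v. v \<in> D \<Longrightarrow>
      ed v \<in> E \<and> t (ed v) = v \<and> en (ed v) = {v, nx v} \<and> \<delta> (nx v) < \<delta> v"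
    by metis
  let ?B = "E - ed ` D"
  have "orient ?B t" using t(1) by (auto simp: orient_def)
  moreover have "card (outs ?B t v) \<le> k" for v
  proof (cases "v \<in> D")
    case True
    then have "ed v \<in> outs E t v" using ed by (simp add: outs_def)
    moreover from True have "outs ?B t v \<subseteq> outs E t v - {ed v}" by (auto simp: outs_def)
    ultimately have "card (outs ?B t v) < card (outs E t v)"
      using finite_outs[of E t v] by (intro psubset_card_mono) auto
    then show ?thesis using t(2)[of v] by simp
  next
    case False
    have "card (outs E t v) \<le> k"
    proof (cases "v \<in> V")
      case False
      then have "outs E t v = {}" using t(1) ends_subset by (auto simp: outs_def orient_def)
      then show ?thesis by simp
    qed (use False in \<open>simp add: D_def\<close>)
    moreover have "card (outs ?B t v) \<le> card (outs E t v)"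
      using finite_outs[of E t v] by (intro card_mono) (auto simp: outs_def)
    ultimately show ?thesis by simp
  qed
  moreover have "forest (ed ` D)"
    unfolding forest_def
  proof (intro ballI allI impI notI)
    fix h a b assume "h \<in> ed ` D" and ab: "en h = {a, b}" "(a, b) \<in> conn (ed ` D - {h})"
    then obtain v where v: "v \<in> D" "h = ed v" by blast
    have "{a, b} = {v, nx v}" using ab(1) v ed by simp
    then have vn: "(v, nx v) \<in> conn (ed ` D - {h})"
      using ab(2) conn_sym by (auto simp: doubleton_eq_iff)
    let ?r = "{(u, nx u) | u. u \<in> D}"
    \<comment> \<open>Without the edge of \<open>v\<close>, every vertex joined to \<open>v\<close>
      leads to \<open>v\<close> under \<open>nx\<close>: a forward step from
      \<open>u \<noteq> v\<close> follows its only chosen arc, a backward step prepends one. For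
      \<open>nx v\<close> this contradicts the decrease of \<open>\<delta>\<close>.\<close>
    have "(w, v) \<in> ?r\<^sup>*" if "(v, w) \<in> conn (ed ` D - {h})" for w
      using that[unfolded conn_def]
    proof (induction rule: rtrancl_induct)
      case (step y z)
      then obtain u where u: "u \<in> D" "ed u \<noteq> h" "en (ed u) = {y, z}" by (auto simp: adj_def)
      then have "{y, z} = {u, nx u}" using ed by simp
      then consider "y = u" "z = nx u" | "y = nx u" "z = u" by (auto simp: doubleton_eq_iff)
      then show ?case
      proof cases
        case 1
        have "u \<noteq> v" using u(2) v(2) by blast
        then show ?thesis using step.IH 1 by (auto elim: converse_rtranclE)
      next
        case 2
        then have "(z, y) \<in> ?r" using u(1) by blast
        then show ?thesis using step.IH by (rule converse_rtrancl_into_rtrancl)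
      qed
    qed simp
    then have "(nx v, v) \<in> ?r\<^sup>*" using vn by blast
    moreover have "\<delta> q \<le> \<delta> p" if "(p, q) \<in> ?r\<^sup>*" for p q
      using that
    proof (induction rule: rtrancl_induct)
      case (step y z)
      then have "\<delta> z < \<delta> y" using ed by auto
      then show ?case using step.IH by simp
    qed simp
    ultimately show False using ed[OF v(1)] by fastforce
  qed
  moreover have "E - ?B = ed ` D" using ed by auto
  ultimately show ?thesis unfolding admissible_def by metis
qed

text \<open>If the claim failed, finiteness and well-foundedness would supply all choices required
  by \<open>extremal\<close>, which \<open>density_contradiction\<close> refutes.\<close>

lemma exists_bounded_admissible:
  assumes "1 \<le> k"
    and density: "\<And>X S. X \<subseteq> V \<Longrightarrow> X \<noteq> {} \<Longrightarrow> S \<subseteq> E \<Longrightarrow> (\<And>e. e \<in> S \<Longrightarrow> en e \<subseteq> X) \<Longrightarrow>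
      card S * (d + k + 1) \<le> (k * (d + k + 1) + d) * card X"
  shows "\<exists>B t. admissible k B t \<and> (\<forall>v\<in>V. csize (E - B) v \<le> d)"
proof (rule ccontr)
  assume no: "\<not> ?thesis"
  have "card S < (k + 1) * card X"
    if "X \<subseteq> V" "X \<noteq> {}" "S \<subseteq> E" "\<And>e. e \<in> S \<Longrightarrow> en e \<subseteq> X" for X S
  proof -
    have "0 < card X" using that(1,2) finite_V by (meson card_gt_0_iff finite_subset)
    then have "(k * (d + k + 1) + d) * card X < (k + 1) * card X * (d + k + 1)"
      by (simp add: algebra_simps)
    then have "card S * (d + k + 1) < (k + 1) * card X * (d + k + 1)"
      using density[OF that] by (rule le_less_trans[rotated])
    then show ?thesis by (rule mult_less_cancel2[THEN iffD1, THEN conjunct2])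
  qed
  then obtain B0 t0 where adm0: "admissible k B0 t0" using exists_admissible by blast
  define Ad where "Ad p \<longleftrightarrow> admissible k (fst p) (snd p)" for p
  have bound: "card B < Suc (card E)" if "admissible k B t" for B t
    using that finite_E card_mono[of E B] by (simp add: admissible_def orient_def le_imp_less_Suc)
  then have "\<forall>p. Ad p \<longrightarrow> card (fst p) < Suc (card E)" by (simp add: Ad_def)
  moreover have "Ad (B0, t0)" using adm0 by (simp add: Ad_def)
  ultimately obtain p where p: "Ad p" "\<And>p'. Ad p' \<Longrightarrow> card (fst p') \<le> card (fst p)"
    using ex_has_greatest_nat[of Ad "(B0, t0)" "\<lambda>p. card (fst p)" "Suc (card E)"] by blast
  define b where "b = card (fst p)"
  have b_max: "card B \<le> b" if "admissible k B t" for B t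
    using p(2)[of "(B, t)"] that by (simp add: Ad_def b_def)
  define bounded where
    "bounded m B t \<longleftrightarrow> admissible k B t \<and> card B = b \<and> (\<forall>v\<in>V. csize (E - B) v \<le> m)" for m B t
  have "bounded (card E) (fst p) (snd p)"
    using p(1) finite_E card_mono[OF finite_E] cedges_subset
    unfolding bounded_def csize_def Ad_def b_def by (metis Diff_subset subset_trans)
  then have ex: "\<exists>m B t. bounded m B t" by blast
  define M where "M = (LEAST m. \<exists>B t. bounded m B t)"
  obtain B1 t1 where B1: "bounded M B1 t1"
    unfolding M_def using LeastI_ex[OF ex] by blast
  have d_M: "d < M"
  proof (rule ccontr)
    assume "\<not> d < M"
    then have "\<forall>v\<in>V. csize (E - B1) v \<le> d" using B1 by (auto simp: bounded_def)
    then show False using no B1 by (auto simp: bounded_def)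
  qed
  \<comment> \<open>A bound \<open>M - 1\<close> would contradict the choice of \<open>M\<close>;
    \<open>d < M\<close> ensures that the truncated subtraction really decreases.\<close>
  have M_least: "\<exists>v\<in>V. M \<le> csize (E - B) v" if "admissible k B t" "card B = b" for B t
  proof (rule ccontr)
    assume "\<not> ?thesis"
    then have "\<forall>v\<in>V. csize (E - B) v \<le> M - 1" by force
    then have "bounded (M - 1) B t" using that by (simp add: bounded_def)
    moreover have "M - 1 < M" using d_M by simp
    ultimately show False using not_less_Least unfolding M_def by blast
  qed
  define Q where "Q = {(B, t, ws). bounded M B t \<and> exploration M B t ws}"
  let ?rk = "\<lambda>(B, t, ws). rank M B ws"
  obtain v where v: "v \<in> V" "M \<le> csize (E - B1) v" using M_least[of B1 t1] B1 by (auto simp: bounded_def)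
  then have "csize (E - B1) v = M" using B1 by (simp add: bounded_def le_antisym)
  then have "exploration M B1 t1 [v]" using v(1) by (simp add: exploration_def)
  then have Q1: "(B1, t1, [v]) \<in> Q" using B1 by (simp add: Q_def)
  \<comment> \<open>The order on profiles is well-founded because \<open>lex\<close> relates only
    lists of equal length.\<close>
  have wf: "wf (inv_image rank_less ?rk)" by (intro wf_inv_image wf_lex_prod wf_lex wf_less_than)
  obtain q where q: "q \<in> Q" "\<And>q'. (q', q) \<in> inv_image rank_less ?rk \<Longrightarrow> q' \<notin> Q"
    by (rule wfE_min[OF wf Q1]) (rule that)
  obtain B t ws where qd: "q = (B, t, ws)" by (cases q)
  have Bt: "bounded M B t" "exploration M B t ws" using q(1) by (auto simp: Q_def qd)
  interpret extremal G k d M B t ws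
  proof
    show "admissible k B t" "exploration M B t ws" "d < M"
      using Bt d_M by (auto simp: bounded_def)
    show "csize (E - B) v \<le> M" if "v \<in> V" for v using Bt that by (simp add: bounded_def)
    have cB: "card B = b" using Bt by (simp add: bounded_def)
    show "card B' \<le> card B" if "admissible k B' t'" for B' t' using that b_max cB by simp
    show "\<exists>v\<in>V. M \<le> csize (E - B') v" if "admissible k B' t'" "card B' = card B" for B' t'
      using that M_least cB by simp
    show "(rank M B' ws', rank M B ws) \<notin> rank_less"
      if "admissible k B' t'" "card B' = card B" "\<And>v. v \<in> V \<Longrightarrow> csize (E - B') v \<le> M"
        "exploration M B' t' ws'" for B' t' ws'
    proof -
      have "(B', t', ws') \<in> Q" using that cB by (simp add: Q_def bounded_def)
      then show ?thesis using q(2)[of "(B', t', ws')"] by (auto simp: qd)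
    qed
  qed
  show False using density_contradiction[OF assms(1) density] by blast
qed

end

subsection \<open>Cycles and pseudoforests\<close>

lemma is_cycle_edge_ends:
  assumes "is_cycle C" "e \<in> edges C"
  shows "ends C e \<subseteq> verts C"
proof -
  obtain vs es where c: "vs \<noteq> []" "length es = length vs" "verts C = set vs" "edges C = set es"
    "\<And>i. i < length vs \<Longrightarrow> ends C (es ! i) = {vs ! i, vs ! (Suc i mod length vs)}"
    using assms(1) unfolding is_cycle_def by blast
  obtain i where i: "i < length vs" "e = es ! i"
    using assms(2) c(2,4) by (auto simp: in_set_conv_nth)
  have "Suc i mod length vs < length vs" using c(1) by simp
  then show ?thesis using c(3) c(5)[OF i(1)] i by simp
qed

text \<open>Each edge with tail in \<open>U\<close> occupies a cyclic position whose vertex and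
  successor both lie in \<open>U\<close>. There are as many such edges as positions with vertex in
  \<open>U\<close>, so these positions are closed under successor.\<close>

lemma cycle_closed_subset:
  assumes "is_cycle C" and tails: "bij_betw t (edges C) (verts C)"
    and "U \<subseteq> verts C" "U \<noteq> {}" and closed: "\<And>e. e \<in> edges C \<Longrightarrow> t e \<in> U \<Longrightarrow> ends C e \<subseteq> U"
  shows "U = verts C"
proof -
  obtain vs es where c: "vs \<noteq> []" "length es = length vs" "distinct vs" "distinct es"
    "verts C = set vs" "edges C = set es"
    "\<And>i. i < length vs \<Longrightarrow> ends C (es ! i) = {vs ! i, vs ! (Suc i mod length vs)}"
    using assms(1) unfolding is_cycle_def by blast
  let ?n = "length vs"
  define I where "I = {i. i < ?n \<and> vs ! i \<in> U}"
  define J where "J = {i \<in> I. Suc i mod ?n \<in> I}"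
  have n: "0 < ?n" using c(1) by simp
  have finI: "finite I" by (simp add: I_def)
  have "U = (!) vs ` I" using assms(3) c(5) by (auto simp: I_def in_set_conv_nth image_iff subset_iff)
  moreover have "inj_on ((!) vs) I" using c(3) by (auto simp: I_def inj_on_def nth_eq_iff_index_eq)
  ultimately have card_U: "card U = card I" by (simp add: card_image)
  let ?F = "{e \<in> edges C. t e \<in> U}"
  have "t ` ?F = U" using tails assms(3) by (auto simp: bij_betw_def)
  moreover have "inj_on t ?F" using tails by (auto simp: bij_betw_def inj_on_def)
  ultimately have "card ?F = card U" using card_image by metis
  moreover have "?F \<subseteq> (!) es ` J"
  proof
    fix e assume e: "e \<in> ?F"
    then obtain i where i: "i < ?n" "e = es ! i" using c(2,6) by (auto simp: in_set_conv_nth)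
    then have "{vs ! i, vs ! (Suc i mod ?n)} \<subseteq> U" using closed[of e] e c(7) by auto
    then have "i \<in> J" using i n by (auto simp: J_def I_def)
    then show "e \<in> (!) es ` J" using i by blast
  qed
  then have "card ?F \<le> card J"
    using finI by (intro surj_card_le) (auto simp: J_def)
  moreover have JI: "J \<subseteq> I" by (auto simp: J_def)
  ultimately have "J = I" using card_U finI by (intro card_seteq) auto
  then have step: "Suc i mod ?n \<in> I" if "i \<in> I" for i using that by (auto simp: J_def)
  obtain i0 where i0: "i0 \<in> I" using assms(4) \<open>U = (!) vs ` I\<close> by blast
  have iter: "(i0 + j) mod ?n \<in> I" for j
  proof (induction j)
    case 0
    then show ?case using i0 by (simp add: I_def)
  next
    case (Suc j)
    then show ?case using step[OF Suc] by (simp add: mod_Suc_eq)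
  qed
  have "v \<in> U" if v: "v \<in> set vs" for v
  proof -
    obtain m where m: "m < ?n" "v = vs ! m" using v by (auto simp: in_set_conv_nth)
    have "i0 < ?n" using i0 by (simp add: I_def)
    \<comment> \<open>The first \<open>?n - i0\<close> steps complete the round to position 0, and
      \<open>m\<close> more reach the vertex sought.\<close>
    then have "(i0 + (?n - i0 + m)) mod ?n = m" using m(1) by simp
    then have "m \<in> I" using iter[of "?n - i0 + m"] by simp
    then show ?thesis using m(2) by (simp add: I_def)
  qed
  then show ?thesis using assms(3) c(5) by auto
qed

section \<open>Pseudoforest criteria for spanning subgraphs\<close>

context finite_mgraph
begin

abbreviation spanning :: "'e set \<Rightarrow> ('v, 'e) mgraph" where
  "spanning S \<equiv> \<lparr>verts = V, edges = S, ends = en\<rparr>"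

lemma wf_spanning: "S \<subseteq> E \<Longrightarrow> wf_graph (spanning S)"
  using finite_G by (auto simp: finite_graph_def wf_graph_def)

lemma spanning_subgraph: "S \<subseteq> E \<Longrightarrow> subgraph (spanning S) G"
  using wf_spanning by (simp add: subgraph_def)

lemma component_spanning:
  assumes "K \<in> components (spanning S)"
  obtains v where "v \<in> V" "verts K = {w \<in> V. (v, w) \<in> conn S}"
    "edges K = {e \<in> S. en e \<subseteq> verts K}" "ends K = en"
proof -
  obtain v where v: "v \<in> V" "K = component_of (spanning S) v"
    using assms by (auto simp: components_def)
  have "adj_rel (spanning S) = adj S" by (simp add: adj_rel_def adj_def)
  then show thesis
    using that[OF v(1)] v(2) by (simp add: component_of_def conn_def Let_def)
qed

lemma card_component_edges:
  assumes "S \<subseteq> E" "\<And>v. v \<in> V \<Longrightarrow> csize S v \<le> d" "K \<in> components (spanning S)"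
  shows "card (edges K) \<le> d"
proof -
  obtain v where v: "v \<in> V" "verts K = {w \<in> V. (v, w) \<in> conn S}"
    "edges K = {e \<in> S. en e \<subseteq> verts K}"
    using assms(3) by (rule component_spanning)
  have "edges K \<subseteq> cedges S v"
  proof
    fix e assume "e \<in> edges K"
    then have e: "e \<in> S" "en e \<subseteq> verts K" using v(3) by auto
    then obtain u where "u \<in> en e" using assms(1) ends_nonempty by blast
    then show "e \<in> cedges S v" using e v(2) by (auto simp: cedges_def)
  qed
  then have "card (edges K) \<le> csize S v"
    unfolding csize_def using finite_cedges[OF assms(1)] by (intro card_mono)
  then show ?thesis using assms(2)[OF v(1)] by simp
qed

lemma pseudoforest_spanningI:
  assumes "S \<subseteq> E"
    and "\<And>C D u w. is_cycle C \<Longrightarrow> is_cycle D \<Longrightarrow> edges C \<subseteq> S \<Longrightarrow> edges D \<subseteq> S \<Longrightarrow>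
      ends C = en \<Longrightarrow> ends D = en \<Longrightarrow> u \<in> verts C \<Longrightarrow> w \<in> verts D \<Longrightarrow> (u, w) \<in> conn S \<Longrightarrow>
      verts C = verts D \<and> edges C = edges D"
  shows "pseudoforest (spanning S)"
  unfolding pseudoforest_def
proof (intro conjI ballI allI impI)
  show "wf_graph (spanning S)" using wf_spanning[OF assms(1)] .
  fix K C D
  assume K: "K \<in> components (spanning S)"
    and CD: "subgraph C K \<and> is_cycle C \<and> subgraph D K \<and> is_cycle D"
  obtain v where v: "verts K = {w \<in> V. (v, w) \<in> conn S}"
    "edges K = {e \<in> S. en e \<subseteq> verts K}" "ends K = en"
    using K by (rule component_spanning)
  have "verts C \<noteq> {}" "verts D \<noteq> {}" using CD by (auto simp: is_cycle_def)
  then obtain u w where uw: "u \<in> verts C" "w \<in> verts D" by blast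
  then have "(v, u) \<in> conn S" "(v, w) \<in> conn S" using CD v(1) by (auto simp: subgraph_def)
  then have "(u, w) \<in> conn S" using conn_sym conn_trans by blast
  moreover have "edges C \<subseteq> S" "edges D \<subseteq> S" "ends C = en" "ends D = en"
    using CD v(2,3) by (auto simp: subgraph_def)
  ultimately have "verts C = verts D \<and> edges C = edges D \<and> ends C = ends D"
    using assms(2)[of C D u w] CD uw by auto
  then show "C = D" by (cases C, cases D) auto
qed

lemma outs_unique:
  assumes "S \<subseteq> E" "card (outs S t v) \<le> 1" "e \<in> S" "e' \<in> S" "t e = v" "t e' = v"
  shows "e = e'"
proof -
  have "e \<in> outs S t v" "e' \<in> outs S t v" using assms by (auto simp: outs_def)
  then show ?thesis
    using assms(2) finite_outs[OF assms(1)] card_le_Suc0_iff_eq[of "outs S t v"] by auto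
qed

text \<open>Tails are distinct when every vertex has at most one outgoing edge, and a cycle has as
  many edges as vertices.\<close>

lemma functional_cycle_tails:
  assumes "orient S t" "\<And>v. card (outs S t v) \<le> 1"
    and C: "is_cycle C" "edges C \<subseteq> S" "ends C = en"
  shows "bij_betw t (edges C) (verts C)"
proof -
  have SE: "S \<subseteq> E" using assms(1) by (simp add: orient_def)
  have "inj_on t (edges C)"
    using outs_unique[OF SE assms(2)] C(2) by (intro inj_onI) blast
  moreover have sub: "t ` edges C \<subseteq> verts C"
    using is_cycle_edge_ends[OF C(1)] C(2,3) assms(1) by (fastforce simp: orient_def)
  moreover have "card (edges C) = card (verts C)" "finite (verts C)"
    using C(1) by (auto simp: is_cycle_def distinct_card)
  ultimately show ?thesis
    unfolding bij_betw_def using card_image card_subset_eq by metis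
qed

text \<open>A common descendant is maintained along the walk. Going against an arc keeps it; going
  along an arc follows the unique way towards it, or moves it forward if it is the current
  vertex.\<close>

lemma functional_confluence:
  assumes "orient S t" "\<And>v. card (outs S t v) \<le> 1" "(u, w) \<in> conn S"
  shows "\<exists>p. (u, p) \<in> (arcs S t)\<^sup>* \<and> (w, p) \<in> (arcs S t)\<^sup>*"
  using assms(3)[unfolded conn_def]
proof (induction rule: rtrancl_induct)
  case (step y z)
  have SE: "S \<subseteq> E" using assms(1) by (simp add: orient_def)
  obtain p where p: "(u, p) \<in> (arcs S t)\<^sup>*" "(y, p) \<in> (arcs S t)\<^sup>*" using step.IH by blast
  obtain e where e: "e \<in> S" "en e = {y, z}" using step.hyps(2) by (auto simp: adj_def)
  then consider "t e = z" | "t e = y" using assms(1) by (auto simp: orient_def)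
  then show ?case
  proof cases
    case 1
    then have "(z, y) \<in> arcs S t" using e by (auto simp: arcs_def insert_commute)
    then show ?thesis using p by (meson converse_rtrancl_into_rtrancl)
  next
    case 2
    then have yz: "(y, z) \<in> arcs S t" using e by (auto simp: arcs_def)
    from p(2) show ?thesis
    proof (cases rule: converse_rtranclE)
      case base
      then show ?thesis using p(1) yz by (meson rtrancl.simps)
    next
      case (step x)
      obtain e' where e': "e' \<in> S" "t e' = y" "en e' = {y, x}" using step(1) by (rule arcsE)
      then have "e' = e" using outs_unique[OF SE assms(2)] e 2 by blast
      then have "x = z" using e' e by (auto simp: doubleton_eq_iff)
      then show ?thesis using step(2) p(1) by blast
    qed
  qed
qed blast

text \<open>Arcs cannot leave a cycle, as each of its vertices spends its only outgoing edge on it.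
  By confluence two cycles in one component meet; their common vertices are closed under arcs and
  hence make up each cycle.\<close>

lemma functional_pseudoforest:
  assumes "orient S t" "\<And>v. card (outs S t v) \<le> 1"
  shows "pseudoforest (spanning S)"
proof (rule pseudoforest_spanningI)
  show SE: "S \<subseteq> E" using assms(1) by (simp add: orient_def)
  fix C D u w
  assume C: "is_cycle C" "edges C \<subseteq> S" "ends C = en" and u: "u \<in> verts C"
    and D: "is_cycle D" "edges D \<subseteq> S" "ends D = en" and w: "w \<in> verts D"
    and uw: "(u, w) \<in> conn S"
  have uniq: "e = e'" if "e \<in> S" "e' \<in> S" "t e = t e'" for e e'
    using outs_unique[OF SE assms(2)] that by metis
  have out: "\<exists>e\<in>edges X. t e = x"
    if "is_cycle X" "edges X \<subseteq> S" "ends X = en" "x \<in> verts X" for X x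
  proof -
    have "x \<in> t ` edges X"
      using functional_cycle_tails[OF assms that(1-3)] that(4) by (simp add: bij_betw_def)
    then show ?thesis by blast
  qed
  have reach: "q \<in> verts X"
    if X: "is_cycle X" "edges X \<subseteq> S" "ends X = en" and "x \<in> verts X" "(x, q) \<in> (arcs S t)\<^sup>*"
    for X x q
    using that(5)
  proof (induction rule: rtrancl_induct)
    case (step y z)
    obtain e where e: "e \<in> S" "t e = y" "en e = {y, z}" using step.hyps(2) by (rule arcsE)
    obtain e' where e': "e' \<in> edges X" "t e' = y" using out[OF X step.IH] by blast
    then have "e = e'" using uniq e X(2) by auto
    then show ?case using is_cycle_edge_ends[OF X(1) e'(1)] e X(3) by auto
  qed (use that in simp)
  let ?U = "verts C \<inter> verts D"
  have U: "?U \<noteq> {}"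
    using functional_confluence[OF assms uw] reach[OF C u] reach[OF D w] by blast
  have closed: "en e \<subseteq> ?U" if e: "e \<in> S" "t e \<in> ?U" for e
  proof -
    obtain e1 e2 where "e1 \<in> edges C" "t e1 = t e" "e2 \<in> edges D" "t e2 = t e"
      using out[OF C, of "t e"] out[OF D, of "t e"] e by blast
    then have "e \<in> edges C" "e \<in> edges D" using uniq[OF e(1)] C(2) D(2) by (metis subset_iff)+
    then show ?thesis
      using is_cycle_edge_ends[OF C(1)] is_cycle_edge_ends[OF D(1)] C(3) D(3) by auto
  qed
  have "?U = verts C"
    using cycle_closed_subset[OF C(1) functional_cycle_tails[OF assms C] _ U] closed C(2,3) by auto
  moreover have "?U = verts D"
    using cycle_closed_subset[OF D(1) functional_cycle_tails[OF assms D] _ U] closed D(2,3) by auto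
  ultimately have V_eq: "verts C = verts D" by simp
  have edges_eq: "edges X = {e \<in> S. t e \<in> verts X}"
    if X: "is_cycle X" "edges X \<subseteq> S" "ends X = en" for X
  proof
    show "edges X \<subseteq> {e \<in> S. t e \<in> verts X}"
      using functional_cycle_tails[OF assms X] X(2) by (auto simp: bij_betw_def)
    show "{e \<in> S. t e \<in> verts X} \<subseteq> edges X"
      using out[OF X] uniq X(2) by blast
  qed
  show "verts C = verts D \<and> edges C = edges D"
    using V_eq edges_eq[OF C] edges_eq[OF D] by simp
qed

text \<open>The other edges of a cycle join the ends of its first edge, which is then no
  bridge.\<close>

lemma forest_acyclic:
  assumes "forest S" "is_cycle C" "edges C \<subseteq> S" "ends C = en"
  shows False
proof -
  obtain vs es where c: "vs \<noteq> []" "length es = length vs" "distinct es" "edges C = set es"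
    "\<And>i. i < length vs \<Longrightarrow> en (es ! i) = {vs ! i, vs ! (Suc i mod length vs)}"
    using assms(2,4) unfolding is_cycle_def by metis
  let ?n = "length vs" let ?T = "S - {es ! 0}"
  have n: "0 < ?n" using c(1) by simp
  have eT: "es ! i \<in> ?T" if "0 < i" "i < ?n" for i
    using that c(2,3,4) n assms(3) nth_eq_iff_index_eq[of es i 0] by auto
  have path: "(vs ! 1, vs ! Suc j) \<in> conn ?T" if "Suc j < ?n" for j
    using that
  proof (induction j)
    case (Suc j)
    have "(vs ! Suc j, vs ! Suc (Suc j)) \<in> conn ?T"
      using eT[of "Suc j"] c(5)[of "Suc j"] Suc.prems by (intro conn_edge[of "es ! Suc j"]) auto
    then show ?case using Suc conn_trans[of "vs ! 1"] by simp
  qed simp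
  have "(vs ! 0, vs ! (Suc 0 mod ?n)) \<in> conn ?T"
  \<comment> \<open>For a loop \<open>Suc 0 mod 1 = 0\<close>, so reflexivity suffices. Otherwise
    the path runs from position 1 to the last vertex and closes up at position 0.\<close>
  proof (cases "?n = 1")
    case False
    define m where "m = ?n - 2"
    have m: "?n = Suc (Suc m)" unfolding m_def using n False by arith
    have "en (es ! Suc m) = {vs ! Suc m, vs ! 0}"
      using c(5)[of "Suc m"] unfolding m by simp
    then have "(vs ! Suc m, vs ! 0) \<in> conn ?T" using eT[of "Suc m"] m by (intro conn_edge) auto
    then have "(vs ! 1, vs ! 0) \<in> conn ?T" using path[of m] m conn_trans by simp
    then show ?thesis using m conn_sym by simp
  qed simp
  moreover have "es ! 0 \<in> S" using c(2,4) n assms(3) by auto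
  ultimately show False using assms(1) c(5)[of 0] n unfolding forest_def by blast
qed

lemma forest_pseudoforest: "S \<subseteq> E \<Longrightarrow> forest S \<Longrightarrow> pseudoforest (spanning S)"
  using forest_acyclic by (intro pseudoforest_spanningI) blast+

text \<open>Each number occurs at most once among the edges leaving a vertex, so every class has
  outdegrees at most one.\<close>

lemma split_into_pseudoforests:
  assumes "orient B t" "\<And>v. card (outs B t v) \<le> k"
  obtains T :: "nat \<Rightarrow> 'e set" where
    "\<And>i. i \<in> {1..k} \<Longrightarrow> T i \<subseteq> B \<and> pseudoforest (spanning (T i))"
    "\<And>i j. i \<noteq> j \<Longrightarrow> T i \<inter> T j = {}" "(\<Union>i\<in>{1..k}. T i) = B"
proof -
  have BE: "B \<subseteq> E" using assms(1) by (simp add: orient_def)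
  have "\<exists>f. f ` outs B t v \<subseteq> {1..k} \<and> inj_on f (outs B t v)" for v
    using card_le_inj[of "outs B t v" "{1..k}"] finite_outs[OF BE] assms(2) by simp
  then obtain c where c: "\<And>v. c v ` outs B t v \<subseteq> {1..k}" "\<And>v. inj_on (c v) (outs B t v)"
    by metis
  define T where "T i = {e \<in> B. c (t e) e = i}" for i
  show thesis
  proof
    fix i :: nat
    have "orient (T i) t" using assms(1) by (auto simp: orient_def T_def)
    moreover have "card (outs (T i) t v) \<le> 1" for v
    proof -
      have "e = e'" if "e \<in> outs (T i) t v" "e' \<in> outs (T i) t v" for e e'
      proof (rule inj_onD[OF c(2)])
        show "c v e = c v e'" "e \<in> outs B t v" "e' \<in> outs B t v"
          using that by (auto simp: outs_def T_def)
      qed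
      moreover have "finite (outs (T i) t v)" using BE by (intro finite_outs) (auto simp: T_def)
      ultimately show ?thesis by (simp add: card_le_Suc0_iff_eq)
    qed
    ultimately show "T i \<subseteq> B \<and> pseudoforest (spanning (T i))"
      using functional_pseudoforest by (auto simp: T_def)
  next
    show "T i \<inter> T j = {}" if "i \<noteq> j" for i j using that by (auto simp: T_def)
    have "c (t e) e \<in> {1..k}" if "e \<in> B" for e
      using c(1)[of "t e"] that by (auto simp: outs_def)
    then show "(\<Union>i\<in>{1..k}. T i) = B" by (auto simp: T_def)
  qed
qed

text \<open>The subgraph with vertices \<open>X\<close> and edges \<open>S\<close> competes in the
  maximum; clearing denominators turns the bound into one between natural numbers.\<close>

lemma mad_density:
  assumes "mad G \<le> 2 * real k + 2 * real d / (real d + real k + 1)"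
    and "X \<subseteq> V" "X \<noteq> {}" "S \<subseteq> E" "\<And>e. e \<in> S \<Longrightarrow> en e \<subseteq> X"
  shows "card S * (d + k + 1) \<le> (k * (d + k + 1) + d) * card X"
proof -
  have "subgraph \<lparr>verts = X, edges = S, ends = en\<rparr> G"
    using assms(2,4,5) finite_G by (auto simp: subgraph_def finite_graph_def wf_graph_def)
  then have "2 * real (card S) / real (card X) \<le> mad G"
    unfolding mad_def using assms(3)
    by (intro Max_ge finite_mad_set finite_G)
      (force intro!: exI[of _ "\<lparr>verts = X, edges = S, ends = en\<rparr>"])
  also note assms(1)
  finally have "2 * real (card S) / real (card X)
      \<le> 2 * real k + 2 * real d / (real d + real k + 1)" .
  moreover have pos: "0 < real (card X)"
    using assms(2,3) finite_V by (metis card_gt_0_iff finite_subset of_nat_0_less_iff)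
  moreover have pos': "0 < real d + real k + 1" by linarith
  ultimately have "real (card S) * (real d + real k + 1)
      \<le> (real k * (real d + real k + 1) + real d) * real (card X)"
    by (simp add: field_simps)
  then have "real (card S * (d + k + 1)) \<le> real ((k * (d + k + 1) + d) * card X)"
    by (simp only: of_nat_mult of_nat_add of_nat_1)
  then show ?thesis by (rule of_nat_le_iff[THEN iffD1])
qed

end

theorem theorem1p7:
  fixes G :: "('v, 'e) mgraph" and k d :: nat
  assumes "k \<ge> 1" and "d \<ge> 1"
    and "finite_graph G"
    and "mad G \<le> 2 * real k + 2 * real d / (real d + real k + 1)"
  shows "\<exists>(T :: nat \<Rightarrow> ('v, 'e) mgraph) (F :: ('v, 'e) mgraph).
           (\<forall>i\<in>{1..k}. subgraph (T i) G \<and> pseudoforest (T i)) \<and>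
           subgraph F G \<and> pseudoforest F \<and>
           (\<forall>i\<in>{1..k}. \<forall>j\<in>{1..k}. i \<noteq> j \<longrightarrow> edges (T i) \<inter> edges (T j) = {}) \<and>
           (\<forall>i\<in>{1..k}. edges (T i) \<inter> edges F = {}) \<and>
           (\<Union>i\<in>{1..k}. edges (T i)) \<union> edges F = edges G \<and>
           (\<forall>K\<in>components F. card (edges K) \<le> d)"
proof -
  interpret finite_mgraph G by unfold_locales (rule assms(3))
  obtain B t where Bt: "admissible k B t" "\<And>v. v \<in> V \<Longrightarrow> csize (E - B) v \<le> d"
    using exists_bounded_admissible[OF assms(1) mad_density[OF assms(4)]] by blast
  have B: "orient B t" "\<And>v. card (outs B t v) \<le> k" "forest (E - B)" "B \<subseteq> E"
    using Bt(1) by (auto simp: admissible_def orient_def)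
  obtain T where T: "\<And>i. i \<in> {1..k} \<Longrightarrow> T i \<subseteq> B \<and> pseudoforest (spanning (T i))"
    "\<And>i j. i \<noteq> j \<Longrightarrow> T i \<inter> T j = {}" "(\<Union>i\<in>{1..k}. T i) = B"
    using split_into_pseudoforests[OF B(1,2)] by blast
  show ?thesis
  proof (intro exI[of _ "\<lambda>i. spanning (T i)"] exI[of _ "spanning (E - B)"] conjI ballI impI)
    fix i assume i: "i \<in> {1..k}"
    then have TB: "T i \<subseteq> B" using T(1) by blast
    then show "subgraph (spanning (T i)) G" using B(4) by (intro spanning_subgraph) auto
    show "pseudoforest (spanning (T i))" using T(1) i by blast
    show "edges (spanning (T i)) \<inter> edges (spanning (E - B)) = {}" using TB by auto
    show "edges (spanning (T i)) \<inter> edges (spanning (T j)) = {}" if "i \<noteq> j" for j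
      using T(2)[OF that] by simp
  next
    show "subgraph (spanning (E - B)) G" by (intro spanning_subgraph) auto
    show "pseudoforest (spanning (E - B))" using B(3) by (intro forest_pseudoforest) auto
    show "(\<Union>i\<in>{1..k}. edges (spanning (T i))) \<union> edges (spanning (E - B)) = E"
      using T(3) B(4) by auto
    show "card (edges K) \<le> d" if "K \<in> components (spanning (E - B))" for K
      using that Bt(2) by (intro card_component_edges[of "E - B"]) auto
  qed
qed

end
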